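(* Let $n\ge 1$ be an integer. For any $0<\alpha\le 1$ and $0<\delta\le 1$, $$\min\bigl\{\mathcal L^n\bigl(N_\delta[A]\cap[0,1]^n\bigr): A\subseteq[0,1]^n \text{ measurable},\ \mathcal L^n(A)\ge\alpha\bigr\}=\min_{t\in\{1,\dots,n\}}\Bigl\{1,\ \bigl(\alpha^{1/t}+\delta\bigr)^t,\ 1-\bigl(\max\{0,(1-\alpha)^{1/t}-\delta\}\bigr)^t\Bigr\}.$$ (In particular the minimum on the left is attained.)
   Context: $\mathcal L^n$ denotes $n$-dimensional Lebesgue measure. For $A\subseteq\mathbb R^n$ and $\delta>0$, $N_\delta[A]=\{x\in\mathbb R^n:\ \|x-a\|_\infty<\delta\text{ for some }a\in A\}$. The right-hand side is the minimum over all the listed quantities as $t$ ranges over $\{1,\dots,n\}$. *)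

theory Defs
  imports "HOL-Analysis.Analysis"
begin

definition linf_nhd :: "real \<Rightarrow> (real ^ 'n) set \<Rightarrow> (real ^ 'n) set"
  where "linf_nhd \<delta> A = {x. \<exists>a\<in>A. infnorm (x - a) < \<delta>}"

text \<open>Here \<open>1 :: real ^ 'n\<close> is the all-ones vector, so this is the closed cube.\<close>
definition unit_cube :: "(real ^ 'n) set"
  where "unit_cube = cbox 0 1"

text \<open>A minimum in the attained sense: the value belongs to the set and bounds it below.\<close>
definition is_minimum :: "real set \<Rightarrow> real \<Rightarrow> bool"
  where "is_minimum S m \<longleftrightarrow> m \<in> S \<and> (\<forall>y\<in>S. m \<le> y)"

end

theory Submission
  imports Defs
begin

text \<open>
  The right-hand side compares three kinds of sets of measure at least \<open>\<alpha>\<close>: the whole cube, the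
  corner boxes \<open>[0,c]^t \<times> [0,1]^(n-t)\<close> with \<open>c^t = \<alpha>\<close>, and the complements of such boxes with
  \<open>c^t = 1 - \<alpha>\<close>. Unless they fill the cube, their neighbourhoods have the listed measures
  (\<open>profile_attained\<close>). It remains to see that no set does better. Write \<open>g n\<close> (below: \<open>profile n\<close>)
  for the right-hand side as a function of \<open>\<alpha>\<close>, extended by \<open>g n 0 = 0\<close>. It is concave on \<open>[0,1]\<close>
  (\<open>profile_concave\<close>).

  The lower bound is proved by induction on the dimension. Slice \<open>A\<close> along one coordinate and let
  \<open>f s\<close> be the measure of the slice at height \<open>s\<close>. By the induction hypothesis the slice of the
  neighbourhood at height \<open>s\<close> has measure at least \<open>g n (f e)\<close> for all \<open>e\<close> within distance \<open>\<delta>\<close>, and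
  the question becomes one about the function \<open>f\<close> on the interval. Up to a small error \<open>f\<close> is a
  uniform mixture of indicator functions of its superlevel sets (\<open>layered_bound\<close>), and the
  \<open>\<delta>\<close>-neighbourhood of a superlevel set of measure \<open>e > 0\<close> has measure at least \<open>min 1 (e + \<delta>)\<close>
  (\<open>widen_measure_le_thicken\<close>). The distribution of \<open>e\<close> is a mixture of two-point distributions with
  the same mean (\<open>two_point_decomposition\<close>). As \<open>g n\<close> is concave, Jensen's inequality leaves only
  mixtures of two nested sets to be considered (\<open>mixture_integral_bound\<close>), and for these an
  inequality between real numbers has to be shown (\<open>two_point_bound\<close>).

  The extreme cases of that inequality are prisms, with constant slices up to a height \<open>x\<close> and empty
  slices above, and coprisms, with full slices up to a height \<open>y\<close> and constant slices above. A prism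
  over a box is a box, a coprism over the complement of a box is the complement of a box, and the
  comparison with cubical boxes and their complements is elementary (\<open>grow_prism\<close>, \<open>shrink_prism\<close>).
  The difficulty lies in the mixed sets, namely prisms over complements of boxes and coprisms over
  boxes; their neighbourhood measure, as a function of the height, can have local minima in the
  interior. The idea is to slice such a set along another coordinate. There its slices take two
  values strictly between empty and full, so the slice function is a convex combination, with a
  positive weight on the constant \<open>\<alpha>\<close>, of that constant and a prism or coprism. By concavity
  (\<open>two_level_bound\<close>) the mixed set cannot realise the smallest mixed value if that value is less
  than \<open>g (n + 1) \<alpha>\<close>. But by compactness the smallest mixed value is attained, so it is not less
  (\<open>mixed_bounds\<close>).
\<close>

section \<open>Boxes, complements of boxes, and the profile\<close>

text \<open>
  Convexity of the power function along the segment from \<open>a\<close> to \<open>1\<close>. The concavity of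
  \<open>(root t x + \<delta>) ^ t\<close> and the inequality for prisms below both follow from it after normalising one
  of the two points to \<open>1\<close>.
\<close>

lemma power_mixture_le:
  fixes a s :: real
  assumes "0 \<le> a" "0 \<le> s" "s \<le> 1"
  shows "(s * a + (1 - s)) ^ n \<le> s * a ^ n + (1 - s)"
proof -
  have "convex_on {0::real..} (\<lambda>x. x ^ n)"
  proof (cases "even n")
    case True
    then show ?thesis
      by (rule convex_on_subset[OF convex_power_even]) auto
  next
    case False
    then show ?thesis by (rule convex_power_odd)
  qed
  from convex_onD[OF this, of "1 - s" a 1] assms show ?thesis by simp
qed

locale enlargement =
  fixes \<delta> :: real
  assumes \<delta>_pos: "0 < \<delta>" and \<delta>_le_1: "\<delta> \<le> 1"
begin

text \<open>
  The measure of the \<open>\<delta>\<close>-neighbourhood of the box \<open>[0,c]^t \<times> [0,1]^(n-t)\<close> with \<open>c^t = x\<close>, as long as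
  \<open>c + \<delta> \<le> 1\<close>. Otherwise the neighbourhood is the whole cube, and \<open>grow t x > 1\<close> drops out of the
  minimum.
\<close>

definition grow :: "nat \<Rightarrow> real \<Rightarrow> real"
  where "grow t x = (root t x + \<delta>) ^ t"

text \<open>
  The measure of what is left of a corner box of measure \<open>x\<close> in \<open>t\<close> coordinates when the
  \<open>\<delta>\<close>-neighbourhood of its complement is removed.
\<close>

definition shrink :: "nat \<Rightarrow> real \<Rightarrow> real"
  where "shrink t x = (max 0 (root t x - \<delta>)) ^ t"

definition cogrow :: "nat \<Rightarrow> real \<Rightarrow> real"
  where "cogrow t p = 1 - shrink t (1 - p)"

text \<open>
  The claimed minimal neighbourhood measure. The value \<open>0\<close> at \<open>p = 0\<close> stands for an empty slice,
  whose neighbourhood is empty; \<open>profile n\<close> jumps there but stays concave. In dimension \<open>0\<close>, where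
  the induction on the dimension starts, it is \<open>1\<close> for \<open>p > 0\<close>.
\<close>

definition profile :: "nat \<Rightarrow> real \<Rightarrow> real"
  where "profile n p =
    (if p \<le> 0 then 0 else Min ({1} \<union> (\<Union>t\<in>{1..n}. {grow t p, cogrow t p})))"

lemma grow_one: "grow 1 x = x + \<delta>"
  by (simp add: grow_def)

lemma cogrow_one: "cogrow 1 x = min 1 (x + \<delta>)"
  by (simp add: cogrow_def shrink_def)

lemma grow_mono: "\<lbrakk>0 < t; 0 \<le> x; x \<le> y\<rbrakk> \<Longrightarrow> grow t x \<le> grow t y"
  unfolding grow_def using \<delta>_pos by (intro power_mono) auto

lemma shrink_mono: "\<lbrakk>0 < t; x \<le> y\<rbrakk> \<Longrightarrow> shrink t x \<le> shrink t y"
  unfolding shrink_def by (intro power_mono max.mono diff_mono real_root_le_mono) auto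

lemma cogrow_mono: "\<lbrakk>0 < t; x \<le> y\<rbrakk> \<Longrightarrow> cogrow t x \<le> cogrow t y"
  unfolding cogrow_def using shrink_mono[of t "1 - y" "1 - x"] by simp

lemma shrink_nonneg: "0 \<le> shrink t x"
  unfolding shrink_def by simp

lemma grow_pos: "\<lbrakk>0 < t; 0 \<le> x\<rbrakk> \<Longrightarrow> 0 < grow t x"
  unfolding grow_def using \<delta>_pos by (intro zero_less_power add_nonneg_pos) auto

lemma grow_ge: "\<lbrakk>0 < t; 0 \<le> x\<rbrakk> \<Longrightarrow> x \<le> grow t x"
  using power_mono[of "root t x" "root t x + \<delta>" t] \<delta>_pos by (simp add: grow_def)

lemma shrink_le: "\<lbrakk>0 < t; 0 \<le> x\<rbrakk> \<Longrightarrow> shrink t x \<le> x"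
  using power_mono[of "max 0 (root t x - \<delta>)" "root t x" t] \<delta>_pos by (simp add: shrink_def)

lemma cogrow_ge: "\<lbrakk>0 < t; x \<le> 1\<rbrakk> \<Longrightarrow> x \<le> cogrow t x"
  using shrink_le[of t "1 - x"] by (simp add: cogrow_def)

text \<open>
  Taking neighbourhoods and passing to the complement are dual: \<open>shrink t\<close> is the inverse of
  \<open>grow t\<close>. Facts about complements of boxes are obtained from facts about boxes in this way.
\<close>

lemma shrink_grow: "\<lbrakk>0 < t; 0 \<le> x\<rbrakk> \<Longrightarrow> shrink t (grow t x) = x"
  using \<delta>_pos by (simp add: shrink_def grow_def real_root_power_cancel)

lemma grow_shrink:
  assumes "0 < t" "\<delta> \<le> root t x"
  shows "grow t (shrink t x) = x"
proof -
  have "0 < root t x" using assms \<delta>_pos by linarith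
  then have "0 < x" using assms by simp
  then show ?thesis using assms by (simp add: shrink_def grow_def real_root_power_cancel)
qed

lemma grow_shrink_ge:
  assumes "0 < t" "0 \<le> x"
  shows "x \<le> grow t (shrink t x)"
proof (cases "\<delta> \<le> root t x")
  case True
  then show ?thesis using grow_shrink[of t x] assms by simp
next
  case False
  then have "root t x ^ t \<le> \<delta> ^ t" using assms by (intro power_mono) auto
  then show ?thesis using assms False by (simp add: shrink_def grow_def zero_power)
qed

text \<open>
  This is Minkowski's inequality for the \<open>t\<close>-norm in disguise. With \<open>X\<close> the \<open>t\<close>-th root of the mean
  \<open>m\<close>, the number \<open>(root t z + \<delta>) / (X + \<delta>)\<close> is a convex combination of \<open>root t z / X\<close> and \<open>1\<close>, with
  a weight that does not depend on \<open>z\<close>. Its \<open>t\<close>-th power is therefore at most an affine function of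
  \<open>z / m\<close> that equals \<open>1\<close> at \<open>z = m\<close>, and averaging over \<open>x\<close> and \<open>y\<close> gives the claim.
\<close>

lemma grow_concave:
  assumes t: "0 < t" and xy: "0 \<le> x" "0 \<le> y" and uv: "0 \<le> u" "0 \<le> v" "u + v = 1"
  shows "u * grow t x + v * grow t y \<le> grow t (u * x + v * y)"
proof -
  define m where "m = u * x + v * y"
  define X where "X = root t m"
  have m0: "0 \<le> m" using assms by (simp add: m_def)
  show ?thesis
  proof (cases "m = 0")
    case True
    then have "u * x = 0" "v * y = 0"
      using assms by (auto simp: m_def add_nonneg_eq_0_iff)
    then show ?thesis using uv by (auto simp flip: distrib_right)
  next
    case False
    then have mp: "0 < m" and Xp: "0 < X" using m0 t by (auto simp: X_def)
    have Xt: "X ^ t = m" using t m0 by (simp add: X_def)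
    \<comment> \<open>the weight of \<open>root t z / X\<close> in the convex combination\<close>
    define s where "s = X / (X + \<delta>)"
    have s: "0 \<le> s" "s \<le> 1" using Xp \<delta>_pos by (auto simp: s_def)
    have key: "grow t z \<le> (X + \<delta>) ^ t * (s * (z / m) + (1 - s))" if z: "0 \<le> z" for z
    proof -
      have "root t z + \<delta> = (X + \<delta>) * (s * (root t z / X) + (1 - s))"
      proof -
        have "s * (X + \<delta>) = X" "(1 - s) * (X + \<delta>) = \<delta>"
          using Xp \<delta>_pos by (auto simp: s_def field_simps)
        moreover have "(X + \<delta>) * (s * q + (1 - s)) = s * (X + \<delta>) * q + (1 - s) * (X + \<delta>)" for q
          by (simp add: algebra_simps)
        ultimately have "(X + \<delta>) * (s * (root t z / X) + (1 - s)) = X * (root t z / X) + \<delta>"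
          by metis
        then show ?thesis using Xp by simp
      qed
      then have "grow t z = (X + \<delta>) ^ t * (s * (root t z / X) + (1 - s)) ^ t"
        by (simp add: grow_def power_mult_distrib)
      also have "\<dots> \<le> (X + \<delta>) ^ t * (s * (root t z / X) ^ t + (1 - s))"
        using power_mixture_le[of "root t z / X" s t] s Xp z t \<delta>_pos
        by (intro mult_left_mono) auto
      finally show ?thesis using t z by (simp add: power_divide Xt)
    qed
    have "u * grow t x + v * grow t y \<le>
        u * ((X + \<delta>) ^ t * (s * (x / m) + (1 - s))) + v * ((X + \<delta>) ^ t * (s * (y / m) + (1 - s)))"
      using key xy uv by (intro add_mono mult_left_mono) auto
    also have "\<dots> = (X + \<delta>) ^ t * (s * ((u * x + v * y) / m) + (u + v) * (1 - s))"
      by (simp add: field_simps add_divide_distrib)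
    also have "\<dots> = (X + \<delta>) ^ t"
      using mp uv by (simp add: m_def)
    finally show ?thesis by (simp add: grow_def X_def m_def)
  qed
qed

text \<open>
  The inverse of an increasing concave function is convex.
\<close>

lemma shrink_convex:
  assumes t: "0 < t" and xy: "0 \<le> x" "0 \<le> y" and uv: "0 \<le> u" "0 \<le> v" "u + v = 1"
  shows "shrink t (u * x + v * y) \<le> u * shrink t x + v * shrink t y"
proof -
  let ?z = "u * shrink t x + v * shrink t y"
  have z: "0 \<le> ?z" using uv shrink_nonneg by auto
  have "u * x + v * y \<le> u * grow t (shrink t x) + v * grow t (shrink t y)"
    using grow_shrink_ge t xy uv by (intro add_mono mult_left_mono) auto
  also have "\<dots> \<le> grow t ?z"
    using assms shrink_nonneg by (intro grow_concave) auto
  finally have "shrink t (u * x + v * y) \<le> shrink t (grow t ?z)"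
    using t by (intro shrink_mono)
  then show ?thesis using shrink_grow[OF t z] by simp
qed

lemma cogrow_concave:
  assumes t: "0 < t" and xy: "x \<le> 1" "y \<le> 1" and uv: "0 \<le> u" "0 \<le> v" "u + v = 1"
  shows "u * cogrow t x + v * cogrow t y \<le> cogrow t (u * x + v * y)"
proof -
  have "u * (1 - a) + v * (1 - b) = 1 - (u * a + v * b)" for a b
    using uv by algebra
  then show ?thesis
    using shrink_convex[of t "1 - x" "1 - y" u v] assms by (simp add: cogrow_def)
qed

text \<open>
  Multiplying a box in \<open>t\<close> coordinates by an interval of length \<open>w\<close> gives a box in \<open>t + 1\<close>
  coordinates that need not be a cube, and cubes have the smaller neighbourhoods. The inequality is
  the subadditivity of \<open>(z, y) \<mapsto> z ^ (t + 1) / y ^ t\<close>, applied to \<open>(X, r) + (\<delta>, \<delta>)\<close>.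
\<close>

lemma grow_prism:
  assumes t: "0 < t" and w: "0 \<le> w" and p: "0 \<le> p"
  shows "grow (Suc t) (w * p) \<le> (w + \<delta>) * grow t p"
proof (cases "p = 0")
  case True
  then show ?thesis using w t \<delta>_pos by (simp add: grow_def mult_right_mono)
next
  case False
  define r where "r = root t p"
  define X where "X = root (Suc t) (w * p)"
  have r: "0 < r" using False p t by (simp add: r_def)
  have X: "0 \<le> X" using w p by (simp add: X_def)
  have rt: "r ^ t = p" using t p by (simp add: r_def)
  have XS: "X ^ Suc t = w * p" unfolding X_def using w p by (intro real_root_pow_pos2) auto
  \<comment> \<open>\<open>(X + \<delta>) / (r + \<delta>)\<close> is the combination of \<open>X / r\<close> and \<open>1\<close> with weights \<open>s\<close> and \<open>1 - s\<close>\<close>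
  define s where "s = r / (r + \<delta>)"
  have s: "0 \<le> s" "s \<le> 1" using r \<delta>_pos by (auto simp: s_def)
  have rd: "0 < r + \<delta>" using r \<delta>_pos by simp
  have sr: "s * (r + \<delta>) = r" "(1 - s) * (r + \<delta>) = \<delta>"
    using rd by (auto simp: s_def field_simps)
  have "X + \<delta> = (r + \<delta>) * (s * (X / r) + (1 - s))"
  proof -
    have "(r + \<delta>) * (s * q + (1 - s)) = s * (r + \<delta>) * q + (1 - s) * (r + \<delta>)" for q
      by (simp add: algebra_simps)
    from this[of "X / r"]
    have "(r + \<delta>) * (s * (X / r) + (1 - s)) = s * (r + \<delta>) * (X / r) + (1 - s) * (r + \<delta>)" .
    then show ?thesis unfolding sr using r by simp
  qed
  then have "(X + \<delta>) ^ Suc t = (r + \<delta>) ^ Suc t * (s * (X / r) + (1 - s)) ^ Suc t"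
    by (simp only: power_mult_distrib)
  also have "\<dots> \<le> (r + \<delta>) ^ Suc t * (s * (X / r) ^ Suc t + (1 - s))"
    using power_mixture_le[of "X / r" s "Suc t"] s X r rd by (intro mult_left_mono) auto
  also have "\<dots> = (r + \<delta>) ^ t * ((s * (r + \<delta>)) * (X / r) ^ Suc t + (1 - s) * (r + \<delta>))"
  proof -
    have "(r + \<delta>) ^ Suc t * (s * q + (1 - s)) =
        (r + \<delta>) ^ t * ((s * (r + \<delta>)) * q + (1 - s) * (r + \<delta>))" for q
      by (simp add: algebra_simps)
    then show ?thesis .
  qed
  also have "\<dots> = (r + \<delta>) ^ t * (r * (X / r) ^ Suc t + \<delta>)" unfolding sr ..
  also have "r * (X / r) ^ Suc t = w"
  proof -
    have "r * (X / r) ^ Suc t = X ^ Suc t / r ^ t"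
      using r by (simp add: power_divide)
    then show ?thesis unfolding XS rt using False by simp
  qed
  finally show ?thesis by (simp add: grow_def X_def r_def mult.commute)
qed

text \<open>
  The dual of \<open>grow_prism\<close> for complements: the inverse functions reverse the inequality.
\<close>

lemma shrink_prism:
  assumes t: "0 < t" and w: "\<delta> \<le> w" and q: "0 \<le> q"
  shows "(w - \<delta>) * shrink t q \<le> shrink (Suc t) (w * q)"
proof (cases "\<delta> \<le> root t q")
  case True
  have "grow (Suc t) ((w - \<delta>) * shrink t q) \<le> (w - \<delta> + \<delta>) * grow t (shrink t q)"
    using w t shrink_nonneg by (intro grow_prism) auto
  also have "\<dots> = w * q" using grow_shrink[OF t True] by simp
  finally have "shrink (Suc t) (grow (Suc t) ((w - \<delta>) * shrink t q)) \<le> shrink (Suc t) (w * q)"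
    by (intro shrink_mono) auto
  then show ?thesis using w shrink_nonneg[of t q] by (simp add: shrink_grow)
next
  case False
  then have "shrink t q = 0" using t by (simp add: shrink_def zero_power)
  then show ?thesis using shrink_nonneg by simp
qed

lemma profile_nonpos: "p \<le> 0 \<Longrightarrow> profile n p = 0"
  by (simp add: profile_def)

lemma profile_0: "0 < p \<Longrightarrow> profile 0 p = 1"
  by (simp add: profile_def)

lemma profile_Suc:
  assumes "0 < p"
  shows "profile (Suc n) p = min (profile n p) (min (grow (Suc n) p) (cogrow (Suc n) p))"
proof -
  let ?S = "{1} \<union> (\<Union>t\<in>{1..n}. {grow t p, cogrow t p})"
  have "{1} \<union> (\<Union>t\<in>{1..Suc n}. {grow t p, cogrow t p}) =
      insert (grow (Suc n) p) (insert (cogrow (Suc n) p) ?S)"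
    by (auto simp: atLeastAtMostSuc_conv)
  then have "profile (Suc n) p = Min (insert (grow (Suc n) p) (insert (cogrow (Suc n) p) ?S))"
    using assms by (simp add: profile_def)
  also have "\<dots> = min (grow (Suc n) p) (min (cogrow (Suc n) p) (Min ?S))"
    by (subst Min_insert; simp)+
  finally show ?thesis using assms by (simp add: profile_def min.commute min.left_commute)
qed

lemma profile_le_1: "profile n p \<le> 1"
  by (auto simp: profile_def)

lemma profile_pos: "0 < p \<Longrightarrow> p \<le> 1 \<Longrightarrow> 0 < profile n p"
proof (induction n)
  case (Suc n)
  then show ?case
    using grow_pos[of "Suc n" p] cogrow_ge[of "Suc n" p] by (simp add: profile_Suc)
qed (simp add: profile_0)

lemma profile_nonneg: "p \<le> 1 \<Longrightarrow> 0 \<le> profile n p"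
  using profile_pos[of p n] by (cases "p \<le> 0") (auto simp: profile_nonpos)

lemma profile_ge: "p \<le> 1 \<Longrightarrow> p \<le> profile n p"
proof (induction n)
  case 0
  then show ?case by (cases "p \<le> 0") (auto simp: profile_0 profile_nonpos)
next
  case (Suc n)
  then show ?case using grow_ge[of "Suc n" p] cogrow_ge[of "Suc n" p]
    by (cases "p \<le> 0") (auto simp: profile_Suc profile_nonpos)
qed

lemma profile_one: "profile n 1 = 1"
  using profile_ge[of 1 n] profile_le_1[of n 1] by simp

lemma profile_Suc_le: "profile (Suc n) p \<le> profile n p"
  by (cases "p \<le> 0") (auto simp: profile_Suc profile_nonpos)

lemma profile_mono: "p \<le> q \<Longrightarrow> q \<le> 1 \<Longrightarrow> profile n p \<le> profile n q"
proof (cases "p \<le> 0")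
  case True
  assume "p \<le> q" "q \<le> 1"
  then show ?thesis using True profile_nonneg by (simp add: profile_nonpos)
next
  case False
  assume pq: "p \<le> q" "q \<le> 1"
  show ?thesis
  proof (induction n)
    case 0
    then show ?case using False pq by (simp add: profile_0)
  next
    case (Suc n)
    then show ?case
      using False pq grow_mono[of "Suc n" p q] cogrow_mono[of "Suc n" p q]
      by (auto simp: profile_Suc min_le_iff_disj)
  qed
qed

lemma profile_le_grow: "0 < p \<Longrightarrow> profile (Suc n) p \<le> grow (Suc n) p"
  and profile_le_cogrow: "0 < p \<Longrightarrow> profile (Suc n) p \<le> cogrow (Suc n) p"
  by (auto simp: profile_Suc)

lemma profile_le_add: "0 < p \<Longrightarrow> profile (Suc n) p \<le> p + \<delta>"
proof (induction n)
  case 0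
  then show ?case using profile_le_grow[of p 0] by (simp add: grow_def)
next
  case (Suc n)
  then show ?case using profile_Suc_le[of "Suc n" p] by simp
qed

text \<open>
  For positive arguments this is the concavity of the members of the minimum. It extends to \<open>0\<close>
  because the value \<open>0\<close> taken there is below the values of all members.
\<close>

lemma profile_concave:
  assumes xy: "0 \<le> x" "x \<le> 1" "0 \<le> y" "y \<le> 1" and uv: "0 \<le> u" "0 \<le> v" "u + v = 1"
  shows "u * profile n x + v * profile n y \<le> profile n (u * x + v * y)"
proof -
  have le: "u * x + v * y \<le> 1"
    using mult_left_mono[of x 1 u] mult_left_mono[of y 1 v] assms by linarith
  show ?thesis
  proof (cases "u * x + v * y \<le> 0")
    case True
    then have "u * x = 0" "v * y = 0"
      using assms by (smt (verit) mult_nonneg_nonneg)+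
    then show ?thesis by (auto simp: profile_nonpos)
  next
    case False
    show ?thesis
    proof (induction n)
      case 0
      have "u * profile 0 x + v * profile 0 y \<le> u * 1 + v * 1"
        using uv profile_le_1 by (intro add_mono mult_left_mono) auto
      then show ?case using uv False by (simp add: profile_0)
    next
      case (Suc n)
      have a: "u * profile (Suc n) x + v * profile (Suc n) y \<le> u * profile n x + v * profile n y"
        using uv profile_Suc_le by (intro add_mono mult_left_mono) auto
      have gr: "profile (Suc n) z \<le> grow (Suc n) z" if "0 \<le> z" for z
        using profile_le_grow[of z n] grow_pos[of "Suc n" z] that
        by (cases "z = 0") (auto simp: profile_nonpos)
      have cg: "profile (Suc n) z \<le> cogrow (Suc n) z" if "0 \<le> z" for z
        using profile_le_cogrow[of z n] cogrow_ge[of "Suc n" 0] that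
        by (cases "z = 0") (auto simp: profile_nonpos)
      have b: "u * profile (Suc n) x + v * profile (Suc n) y \<le> u * grow (Suc n) x + v * grow (Suc n) y"
        using uv gr xy by (intro add_mono mult_left_mono) auto
      have c: "u * profile (Suc n) x + v * profile (Suc n) y \<le> u * cogrow (Suc n) x + v * cogrow (Suc n) y"
        using uv cg xy by (intro add_mono mult_left_mono) auto
      show ?case
        using a b c Suc.IH grow_concave[of "Suc n" x y u v] cogrow_concave[of "Suc n" x y u v] assms False
        by (simp add: profile_Suc)
    qed
  qed
qed

lemma profile_convex_on: "convex_on {0..1} (\<lambda>x. - profile n x)"
  unfolding convex_on_def using profile_concave[of _ _ _ _ n] by fastforce

lemma profile_continuous: "continuous_on {0<..} (profile n)"
proof (induction n)
  case 0
  have "continuous_on {0::real<..} (\<lambda>x. 1::real)" by (rule continuous_on_const)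
  then show ?case by (rule continuous_on_cong[THEN iffD1, rotated 2]) (auto simp: profile_0)
next
  case (Suc n)
  have "continuous_on {0<..} (\<lambda>x. min (profile n x) (min (grow (Suc n) x) (cogrow (Suc n) x)))"
    unfolding grow_def cogrow_def shrink_def by (intro continuous_intros Suc)
  then show ?case by (rule continuous_on_cong[THEN iffD1, rotated 2]) (auto simp: profile_Suc)
qed

end

context enlargement
begin

section \<open>Prisms and coprisms\<close>

text \<open>
  A prism over \<open>[0,x]\<close> has slices of measure \<open>p\<close> at the heights in \<open>[0,x]\<close> and empty slices above; a
  coprism has full slices at the heights in \<open>[0,y]\<close> and slices of measure \<open>p\<close> above. If
  neighbourhoods of slices are measured by \<open>profile n\<close>, the neighbourhoods of these sets should be
  at least as large as \<open>profile (Suc n)\<close> of their measure. The conditions on \<open>x\<close> and \<open>y\<close> say that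
  the jump stays in \<open>[0,1]\<close> when it is moved up by \<open>\<delta>\<close>.
\<close>

definition prism_bound :: "nat \<Rightarrow> bool"
  where "prism_bound n \<longleftrightarrow> (\<forall>x p. 0 < x \<longrightarrow> x \<le> 1 - \<delta> \<longrightarrow> 0 < p \<longrightarrow> p \<le> 1 \<longrightarrow>
    profile (Suc n) (x * p) \<le> (x + \<delta>) * profile n p)"

definition coprism_bound :: "nat \<Rightarrow> bool"
  where "coprism_bound n \<longleftrightarrow> (\<forall>y p. 0 \<le> y \<longrightarrow> y \<le> 1 - \<delta> \<longrightarrow> 0 \<le> p \<longrightarrow> p \<le> 1 \<longrightarrow> 0 < y + (1 - y) * p \<longrightarrow>
    profile (Suc n) (y + (1 - y) * p) \<le> 1 - (1 - y - \<delta>) * (1 - profile n p))"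

text \<open>
  The neighbourhood measure of a prism of measure \<open>\<alpha>\<close> over \<open>[0,x]\<close> whose slices are complements of
  boxes. In general such a set is neither a box nor the complement of one.
\<close>

definition prism_mixed :: "nat \<Rightarrow> real \<Rightarrow> real \<Rightarrow> real"
  where "prism_mixed t \<alpha> x = (x + \<delta>) * cogrow t (\<alpha> / x)"

text \<open>
  The neighbourhood measure of a coprism of measure \<open>\<alpha>\<close> whose upper slices are boxes.
\<close>

definition coprism_mixed :: "nat \<Rightarrow> real \<Rightarrow> real \<Rightarrow> real"
  where "coprism_mixed t \<alpha> y = 1 - (1 - y - \<delta>) * (1 - min 1 (grow t ((\<alpha> - y) / (1 - y))))"

text \<open>
  A prism over a box is a box, and a prism over a set of lower type is covered by the induction on
  the dimension, so only prisms over complements of boxes in all coordinates need a hypothesis.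
  Dually for coprisms in the next lemma. A number \<open>\<mu>\<close> below the profile is kept variable, since
  these lemmas are applied while the bound for the mixed sets is still unknown.
\<close>

lemma prism_bound_via_mixed:
  assumes A: "prism_bound n" and \<alpha>: "0 < \<alpha>" "\<alpha> \<le> 1"
    and \<mu>: "\<mu> \<le> profile (Suc (Suc n)) \<alpha>"
    and low: "\<mu> \<le> prism_mixed (Suc n) \<alpha> x"
    and x: "\<alpha> \<le> x" "x \<le> 1 - \<delta>"
  shows "\<mu> \<le> (x + \<delta>) * profile (Suc n) (\<alpha> / x)"
proof -
  have x0: "0 < x" using \<alpha> x by simp
  have p: "0 < \<alpha> / x" "\<alpha> / x \<le> 1" and xp: "x * (\<alpha> / x) = \<alpha>"
    using \<alpha> x x0 by auto
  have "\<mu> \<le> (x + \<delta>) * profile n (\<alpha> / x)"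
    using A[unfolded prism_bound_def, rule_format, OF x0 x(2) p] \<mu> profile_Suc_le[of "Suc n" \<alpha>]
    unfolding xp by linarith
  moreover have "\<mu> \<le> (x + \<delta>) * grow (Suc n) (\<alpha> / x)"
    using grow_prism[of "Suc n" x "\<alpha> / x"] p x0 \<mu> profile_le_grow[of \<alpha> "Suc n"] \<alpha>
    unfolding xp by linarith
  moreover have "\<mu> \<le> (x + \<delta>) * cogrow (Suc n) (\<alpha> / x)"
    using low by (simp add: prism_mixed_def)
  ultimately show ?thesis
    using p by (auto simp: profile_Suc min_def)
qed

lemma coprism_bound_via_mixed:
  assumes B: "coprism_bound n" and \<alpha>: "0 < \<alpha>" "\<alpha> \<le> 1"
    and \<mu>: "\<mu> \<le> profile (Suc (Suc n)) \<alpha>"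
    and high: "\<mu> \<le> coprism_mixed (Suc n) \<alpha> y"
    and y: "0 \<le> y" "y \<le> \<alpha>" "y \<le> 1 - \<delta>"
  shows "\<mu> \<le> 1 - (1 - y - \<delta>) * (1 - profile (Suc n) ((\<alpha> - y) / (1 - y)))"
proof -
  define p where "p = (\<alpha> - y) / (1 - y)"
  have y1: "0 < 1 - y" using y \<delta>_pos by simp
  have p: "0 \<le> p" "p \<le> 1" using \<alpha> y y1 by (auto simp: p_def)
  have yp: "y + (1 - y) * p = \<alpha>" using y1 by (simp add: p_def)
  have c: "0 \<le> 1 - y - \<delta>" using y by simp
  show ?thesis
  proof (cases "p = 0")
    case True
    then have "\<alpha> = y" using yp by simp
    then show ?thesis using \<mu> profile_le_add[of \<alpha> "Suc n"] \<alpha> by (simp add: profile_nonpos)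
  next
    case False
    then have p0: "0 < p" using p by simp
    have 1: "\<mu> \<le> 1 - (1 - y - \<delta>) * (1 - profile n p)"
      using B[unfolded coprism_bound_def, rule_format, OF y(1) y(3) p] \<mu> profile_Suc_le[of "Suc n" \<alpha>] \<alpha>
      unfolding yp by linarith
    have 2: "\<mu> \<le> 1 - (1 - y - \<delta>) * (1 - min 1 (grow (Suc n) p))"
      using high by (simp add: coprism_mixed_def p_def)
    have 3: "\<mu> \<le> 1 - (1 - y - \<delta>) * (1 - cogrow (Suc n) p)"
    proof -
      have "(1 - y) * (1 - p) = 1 - \<alpha>" using yp by (simp add: algebra_simps)
      then have "(1 - y - \<delta>) * shrink (Suc n) (1 - p) \<le> shrink (Suc (Suc n)) (1 - \<alpha>)"
        using shrink_prism[of "Suc n" "1 - y" "1 - p"] p c by simp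
      moreover have "\<mu> \<le> cogrow (Suc (Suc n)) \<alpha>"
        using \<mu> profile_le_cogrow[of \<alpha> "Suc n"] \<alpha> by linarith
      ultimately show ?thesis by (simp add: cogrow_def)
    qed
    have "profile (Suc n) p = min (profile n p) (min (min 1 (grow (Suc n) p)) (cogrow (Suc n) p))"
      using p0 profile_le_1[of n p] by (auto simp: profile_Suc)
    then have "profile (Suc n) p \<in> {profile n p, min 1 (grow (Suc n) p), cogrow (Suc n) p}"
      by (auto simp: min_def)
    then show ?thesis using 1 2 3 unfolding p_def[symmetric] by auto
  qed
qed

text \<open>
  A slice function with value \<open>M\<close> up to height \<open>s\<close> and \<open>m\<close> above is a convex combination of the
  constant \<open>\<alpha>\<close> and the coprism (if \<open>s \<le> \<alpha>\<close>) or prism (if \<open>s > \<alpha>\<close>) of measure \<open>\<alpha>\<close> that jumps at \<open>s\<close>.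
  By concavity of the profile the neighbourhood bound of the combination is at least the same
  combination of the bounds. The constant \<open>\<alpha>\<close> has positive weight \<open>\<theta>\<close>, because \<open>0 < m\<close> and \<open>M < 1\<close>,
  and its bound is strictly above \<open>\<mu>\<close>; hence the strict inequality.
\<close>

lemma two_level_bound:
  assumes low: "\<And>x. \<alpha> \<le> x \<Longrightarrow> x \<le> 1 - \<delta> \<Longrightarrow> \<mu> \<le> (x + \<delta>) * profile t (\<alpha> / x)"
    and high: "\<And>y. \<lbrakk>0 \<le> y; y \<le> \<alpha>; y \<le> 1 - \<delta>\<rbrakk> \<Longrightarrow> \<mu> \<le> 1 - (1 - y - \<delta>) * (1 - profile t ((\<alpha> - y) / (1 - y)))"
    and \<mu>: "\<mu> < profile t \<alpha>"
    and s: "0 < s" "s \<le> 1 - \<delta>" and Mm: "0 < m" "m \<le> M" "M < 1" and \<alpha>: "s * M + (1 - s) * m = \<alpha>"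
  shows "\<mu> < (\<delta> + s) * profile t M + (1 - \<delta> - s) * profile t m"
proof -
  have s1: "s < 1" using s \<delta>_pos by simp
  have mM: "m \<le> \<alpha>" "\<alpha> \<le> M"
  proof -
    have "s * (M - m) \<ge> 0" "(1 - s) * (M - m) \<ge> 0" using s s1 Mm by auto
    then show "m \<le> \<alpha>" "\<alpha> \<le> M" using \<alpha> by (auto simp: algebra_simps)
  qed
  have \<alpha>01: "0 < \<alpha>" "\<alpha> < 1" using mM Mm by auto
  show ?thesis
  proof (cases "s \<le> \<alpha>")
    case True
    \<comment> \<open>the weight of the constant \<open>\<alpha>\<close>, read off at heights up to \<open>s\<close>, where the coprism is full\<close>
    define \<theta> where "\<theta> = (1 - M) / (1 - \<alpha>)"
    define p where "p = (\<alpha> - s) / (1 - s)"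
    have \<theta>: "0 < \<theta>" "\<theta> \<le> 1" using \<alpha>01 Mm mM by (auto simp: \<theta>_def)
    have p: "0 \<le> p" "p \<le> 1" "(1 - s) * p = \<alpha> - s" using True s1 \<alpha>01 by (auto simp: p_def)
    have M: "M = \<theta> * \<alpha> + (1 - \<theta>) * 1"
    proof -
      have "\<theta> * (1 - \<alpha>) = 1 - M" using \<alpha>01 by (simp add: \<theta>_def)
      then show ?thesis by (simp add: algebra_simps)
    qed
    have m: "m = \<theta> * \<alpha> + (1 - \<theta>) * p"
    proof -
      have "(1 - s) * m = \<alpha> - s * M" using \<alpha> by simp
      also have "\<dots> = (1 - s) * (\<theta> * \<alpha>) + (1 - \<theta>) * (\<alpha> - s)" unfolding M by (simp add: algebra_simps)
      also have "\<dots> = (1 - s) * (\<theta> * \<alpha> + (1 - \<theta>) * p)" unfolding p(3)[symmetric] by (simp add: algebra_simps)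
      finally show ?thesis using s1 by simp
    qed
    have gM: "\<theta> * profile t \<alpha> + (1 - \<theta>) * 1 \<le> profile t M"
      using profile_concave[of \<alpha> 1 \<theta> "1 - \<theta>" t] \<theta> \<alpha>01 unfolding M by (simp add: profile_one)
    have gm: "\<theta> * profile t \<alpha> + (1 - \<theta>) * profile t p \<le> profile t m"
      using profile_concave[of \<alpha> p \<theta> "1 - \<theta>" t] \<theta> \<alpha>01 p unfolding m by simp
    have "\<mu> = \<theta> * \<mu> + (1 - \<theta>) * \<mu>" by (simp add: algebra_simps)
    also have "\<dots> < \<theta> * profile t \<alpha> + (1 - \<theta>) * (1 - (1 - s - \<delta>) * (1 - profile t p))"
      using high[of s] s True \<theta> \<mu> unfolding p_def[symmetric]
      by (intro add_less_le_mono mult_left_mono mult_strict_left_mono) auto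
    also have "\<dots> = (\<delta> + s) * (\<theta> * profile t \<alpha> + (1 - \<theta>) * 1)
        + (1 - \<delta> - s) * (\<theta> * profile t \<alpha> + (1 - \<theta>) * profile t p)"
      by (simp add: algebra_simps)
    also have "\<dots> \<le> (\<delta> + s) * profile t M + (1 - \<delta> - s) * profile t m"
      using gM gm s \<delta>_pos by (intro add_mono mult_left_mono) auto
    finally show ?thesis .
  next
    case False
    \<comment> \<open>the weight of the constant \<open>\<alpha>\<close>, read off at heights above \<open>s\<close>, where the prism is empty\<close>
    define \<theta> where "\<theta> = m / \<alpha>"
    define q where "q = \<alpha> / s"
    have \<theta>: "0 < \<theta>" "\<theta> \<le> 1" using \<alpha>01 Mm mM by (auto simp: \<theta>_def)
    have q: "0 \<le> q" "q \<le> 1" "s * q = \<alpha>" using False s \<alpha>01 by (auto simp: q_def)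
    have m: "m = \<theta> * \<alpha> + (1 - \<theta>) * 0" using \<alpha>01 by (simp add: \<theta>_def)
    have M: "M = \<theta> * \<alpha> + (1 - \<theta>) * q"
    proof -
      have "s * M = \<alpha> - (1 - s) * m" using \<alpha> by simp
      also have "\<dots> = s * (\<theta> * \<alpha>) + (1 - \<theta>) * \<alpha>" unfolding m by (simp add: algebra_simps)
      also have "\<dots> = s * (\<theta> * \<alpha>) + (1 - \<theta>) * (s * q)" unfolding q(3) ..
      also have "\<dots> = s * (\<theta> * \<alpha> + (1 - \<theta>) * q)" by (simp add: algebra_simps)
      finally show ?thesis using s by simp
    qed
    have gM: "\<theta> * profile t \<alpha> + (1 - \<theta>) * profile t q \<le> profile t M"
      using profile_concave[of \<alpha> q \<theta> "1 - \<theta>" t] \<theta> \<alpha>01 q unfolding M by simp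
    have gm: "\<theta> * profile t \<alpha> \<le> profile t m"
      using profile_concave[of \<alpha> 0 \<theta> "1 - \<theta>" t] \<theta> \<alpha>01 unfolding m by (simp add: profile_nonpos)
    have "\<mu> = \<theta> * \<mu> + (1 - \<theta>) * \<mu>" by (simp add: algebra_simps)
    also have "\<dots> < \<theta> * profile t \<alpha> + (1 - \<theta>) * ((s + \<delta>) * profile t q)"
      using low[of s] s False \<theta> \<mu> unfolding q_def[symmetric]
      by (intro add_less_le_mono mult_left_mono mult_strict_left_mono) auto
    also have "\<dots> = (\<delta> + s) * (\<theta> * profile t \<alpha> + (1 - \<theta>) * profile t q)
        + (1 - \<delta> - s) * (\<theta> * profile t \<alpha>)"
      by (simp add: algebra_simps)
    also have "\<dots> \<le> (\<delta> + s) * profile t M + (1 - \<delta> - s) * profile t m"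
      using gM gm s \<delta>_pos by (intro add_mono mult_left_mono) auto
    finally show ?thesis .
  qed
qed

lemma prism_mixed_continuous:
  assumes "0 < \<alpha>" shows "continuous_on {\<alpha>..1 - \<delta>} (prism_mixed t \<alpha>)"
  unfolding prism_mixed_def[abs_def] cogrow_def shrink_def
  using assms by (intro continuous_intros) auto

lemma coprism_mixed_continuous:
  "continuous_on {0..min \<alpha> (1 - \<delta>)} (coprism_mixed t \<alpha>)"
  unfolding coprism_mixed_def[abs_def] grow_def
  using \<delta>_pos by (intro continuous_intros) auto

text \<open>
  The mixed prism is a complement of a box \<open>[0,b]^(n+1)\<close> times an interval of length \<open>u\<close>. Sliced
  along one of the coordinates of the box instead, its slices have measure \<open>u\<close> up to height \<open>1 - b\<close>
  (after reflection), and measure \<open>u * (1 - b ^ n)\<close> above. So \<open>two_level_bound\<close> applies and shows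
  that its neighbourhood measure is strictly above every lower bound \<open>\<mu>\<close> of the mixed values that is
  itself below the profile. For \<open>n = 0\<close> the upper slices would be empty and the argument breaks
  down.
\<close>

lemma prism_mixed_not_minimal:
  assumes A: "prism_bound n" and B: "coprism_bound n" and n: "0 < n"
    and \<alpha>: "0 < \<alpha>" "\<alpha> \<le> 1"
    and low: "\<And>x. \<lbrakk>\<alpha> \<le> x; x \<le> 1 - \<delta>\<rbrakk> \<Longrightarrow> \<mu> \<le> prism_mixed (Suc n) \<alpha> x"
    and high: "\<And>y. \<lbrakk>0 \<le> y; y \<le> \<alpha>; y \<le> 1 - \<delta>\<rbrakk> \<Longrightarrow> \<mu> \<le> coprism_mixed (Suc n) \<alpha> y"
    and \<mu>: "\<mu> < profile (Suc (Suc n)) \<alpha>"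
    and u: "\<alpha> \<le> u" "u \<le> 1 - \<delta>"
  shows "\<mu> < prism_mixed (Suc n) \<alpha> u"
proof -
  have \<mu>': "\<mu> < profile (Suc n) \<alpha>" using \<mu> profile_Suc_le[of "Suc n" \<alpha>] by simp
  have u0: "0 < u" "u < 1" using \<alpha> u \<delta>_pos by auto
  define b where "b = root (Suc n) (1 - \<alpha> / u)"
  have q: "0 \<le> 1 - \<alpha> / u" "1 - \<alpha> / u < 1" using \<alpha> u u0 by auto
  have b0: "0 \<le> b" "b < 1" using q by (auto simp: b_def)
  have bt: "b ^ Suc n = 1 - \<alpha> / u" unfolding b_def using q by (intro real_root_pow_pos2) auto
  show ?thesis
  proof (cases "b \<le> \<delta>")
    case True
    then have "prism_mixed (Suc n) \<alpha> u = u + \<delta>"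
      by (simp add: prism_mixed_def cogrow_def shrink_def b_def[symmetric] zero_power)
    then show ?thesis using \<mu>' profile_le_add[of \<alpha> n] \<alpha> u by simp
  next
    case False
    define s where "s = 1 - b"
    define p where "p = 1 - b ^ n"
    have bn: "0 \<le> b ^ n" "b ^ n < 1" using b0 n by (auto simp: power_less_one_iff)
    have p: "0 < p" "p \<le> 1" using bn by (auto simp: p_def)
    have root_bn: "root n (b ^ n) = b" using n b0 by (simp add: real_root_power_cancel)
    have "\<mu> < (\<delta> + s) * profile (Suc n) u + (1 - \<delta> - s) * profile (Suc n) (u * p)"
    proof (rule two_level_bound[where \<alpha> = \<alpha>])
      show "\<mu> \<le> (x + \<delta>) * profile (Suc n) (\<alpha> / x)" if "\<alpha> \<le> x" "x \<le> 1 - \<delta>" for x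
        using prism_bound_via_mixed[OF A \<alpha> _ low] that \<mu> by simp
      show "\<mu> \<le> 1 - (1 - y - \<delta>) * (1 - profile (Suc n) ((\<alpha> - y) / (1 - y)))"
        if "0 \<le> y" "y \<le> \<alpha>" "y \<le> 1 - \<delta>" for y
        using coprism_bound_via_mixed[OF B \<alpha> _ high] that \<mu> by simp
      have "s * u + (1 - s) * (u * p) = u * (1 - b ^ Suc n)"
        by (simp add: s_def p_def algebra_simps)
      also have "\<dots> = \<alpha>" unfolding bt using u0 by simp
      finally show "s * u + (1 - s) * (u * p) = \<alpha>" .
      show "u * p \<le> u" using p u0 by (simp add: mult_left_le)
    qed (use \<mu>' b0 False p u0 in \<open>auto simp: s_def\<close>)
    also have "\<dots> \<le> (\<delta> + s) * (u + \<delta>) + (1 - \<delta> - s) * ((u + \<delta>) * (1 - (b - \<delta>) ^ n))"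
    proof (intro add_mono mult_left_mono)
      show "profile (Suc n) u \<le> u + \<delta>" using profile_le_add u0 by simp
      have "profile (Suc n) (u * p) \<le> (u + \<delta>) * profile n p"
        using A u0 u p unfolding prism_bound_def by blast
      also have "\<dots> \<le> (u + \<delta>) * cogrow n p"
        using profile_le_cogrow[of p "n - 1"] n p u0 \<delta>_pos by (intro mult_left_mono) auto
      also have "cogrow n p = 1 - (b - \<delta>) ^ n"
        using False by (simp add: cogrow_def shrink_def p_def root_bn)
      finally show "profile (Suc n) (u * p) \<le> (u + \<delta>) * (1 - (b - \<delta>) ^ n)" .
    qed (use b0 False \<delta>_pos in \<open>auto simp: s_def\<close>)
    also have "\<dots> = (u + \<delta>) * (1 - (b - \<delta>) ^ Suc n)"
      by (simp add: s_def algebra_simps)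
    also have "\<dots> = prism_mixed (Suc n) \<alpha> u"
      using False by (simp add: prism_mixed_def cogrow_def shrink_def b_def[symmetric])
    finally show ?thesis .
  qed
qed

text \<open>
  The mixed coprism is the union of a slab of thickness \<open>v\<close> and the cylinder over the box
  \<open>[0,c]^(n+1)\<close>. Along a coordinate of the box its slices have measure \<open>v + (1 - v) * c ^ n\<close> up to
  height \<open>c\<close> and measure \<open>v\<close> above. The slices above are empty for \<open>v = 0\<close>, but then the set is a
  box.
\<close>

lemma coprism_mixed_not_minimal:
  assumes A: "prism_bound n" and B: "coprism_bound n" and n: "0 < n"
    and \<alpha>: "0 < \<alpha>" "\<alpha> \<le> 1"
    and low: "\<And>x. \<lbrakk>\<alpha> \<le> x; x \<le> 1 - \<delta>\<rbrakk> \<Longrightarrow> \<mu> \<le> prism_mixed (Suc n) \<alpha> x"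
    and high: "\<And>y. \<lbrakk>0 \<le> y; y \<le> \<alpha>; y \<le> 1 - \<delta>\<rbrakk> \<Longrightarrow> \<mu> \<le> coprism_mixed (Suc n) \<alpha> y"
    and \<mu>: "\<mu> < profile (Suc (Suc n)) \<alpha>"
    and v: "0 \<le> v" "v \<le> \<alpha>" "v \<le> 1 - \<delta>"
  shows "\<mu> < coprism_mixed (Suc n) \<alpha> v"
proof -
  have \<mu>': "\<mu> < profile (Suc n) \<alpha>" using \<mu> profile_Suc_le[of "Suc n" \<alpha>] by simp
  have v1: "0 < 1 - v" using v \<delta>_pos by simp
  define p where "p = (\<alpha> - v) / (1 - v)"
  have p: "0 \<le> p" "p \<le> 1" using \<alpha> v v1 by (auto simp: p_def)
  have vp: "v + (1 - v) * p = \<alpha>" using v1 by (simp add: p_def)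
  define c where "c = root (Suc n) p"
  have c0: "0 \<le> c" using p by (simp add: c_def)
  have ct: "c ^ Suc n = p" unfolding c_def using p by (intro real_root_pow_pos2) auto
  have gr: "grow (Suc n) p = (c + \<delta>) ^ Suc n" by (simp add: grow_def c_def)
  have mh: "coprism_mixed (Suc n) \<alpha> v = 1 - (1 - v - \<delta>) * (1 - min 1 (grow (Suc n) p))"
    by (simp add: coprism_mixed_def p_def)
  consider "1 \<le> c + \<delta>" | "c + \<delta> < 1" "v = 0" | "c + \<delta> < 1" "c = 0" | "c + \<delta> < 1" "0 < v" "0 < c"
    using c0 v by linarith
  then show ?thesis
  proof cases
    case 1
    then have "1 \<le> (c + \<delta>) ^ Suc n" by (rule one_le_power)
    then have "coprism_mixed (Suc n) \<alpha> v = 1" unfolding mh gr by (simp add: min_absorb1 del: power_Suc)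
    then show ?thesis using \<mu>' profile_le_1[of "Suc n" \<alpha>] by simp
  next
    case 2
    then have "p = \<alpha>" by (simp add: p_def)
    then have "profile (Suc n) \<alpha> \<le> min 1 (grow (Suc n) p)"
      using profile_le_grow[of \<alpha> n] profile_le_1[of "Suc n" \<alpha>] \<alpha> by simp
    also have "\<dots> \<le> coprism_mixed (Suc n) \<alpha> v"
      unfolding mh using 2 \<delta>_pos \<delta>_le_1
        mult_right_mono[of "1 - \<delta>" 1 "1 - min 1 (grow (Suc n) p)"] by simp
    finally show ?thesis using \<mu>' by simp
  next
    case 3
    then have "p = 0" using ct by simp
    then have "v = \<alpha>" using vp by simp
    have "1 - v - \<delta> \<ge> (1 - v - \<delta>) * (1 - min 1 (grow (Suc n) p))"
      using v p grow_pos[of "Suc n" p] by (intro mult_left_le) auto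
    then have "v + \<delta> \<le> coprism_mixed (Suc n) \<alpha> v" unfolding mh by simp
    then show ?thesis using \<mu>' profile_le_add[of \<alpha> n] \<alpha> \<open>v = \<alpha>\<close> by simp
  next
    case 4
    have c1: "c < 1" using 4 \<delta>_pos by simp
    define M where "M = v + (1 - v) * c ^ n"
    have cn: "0 < c ^ n" "c ^ n < 1" using c1 4 n by (auto simp: power_less_one_iff)
    have M: "v \<le> M" "M < 1" "0 < M"
    proof -
      have "(1 - v) * c ^ n < (1 - v) * 1" using cn v1 by (intro mult_strict_left_mono) auto
      moreover have "0 \<le> (1 - v) * c ^ n" using cn v1 by simp
      ultimately show "v \<le> M" "M < 1" "0 < M" using 4 by (auto simp: M_def)
    qed
    have "\<mu> < (\<delta> + c) * profile (Suc n) M + (1 - \<delta> - c) * profile (Suc n) v"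
    proof (rule two_level_bound[where \<alpha> = \<alpha>])
      show "\<mu> \<le> (x + \<delta>) * profile (Suc n) (\<alpha> / x)" if "\<alpha> \<le> x" "x \<le> 1 - \<delta>" for x
        using prism_bound_via_mixed[OF A \<alpha> _ low] that \<mu> by simp
      show "\<mu> \<le> 1 - (1 - y - \<delta>) * (1 - profile (Suc n) ((\<alpha> - y) / (1 - y)))"
        if "0 \<le> y" "y \<le> \<alpha>" "y \<le> 1 - \<delta>" for y
        using coprism_bound_via_mixed[OF B \<alpha> _ high] that \<mu> by simp
      have "c * M + (1 - c) * v = v + (1 - v) * c ^ Suc n"
        by (simp add: M_def algebra_simps)
      then show "c * M + (1 - c) * v = \<alpha>" unfolding ct vp .
    qed (use \<mu>' 4 M in auto)
    also have "\<dots> \<le> (\<delta> + c) * (1 - (1 - v - \<delta>) * (1 - (c + \<delta>) ^ n)) + (1 - \<delta> - c) * (v + \<delta>)"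
    proof (intro add_mono mult_left_mono)
      show "profile (Suc n) v \<le> v + \<delta>" using profile_le_add 4 by simp
      have "profile (Suc n) M \<le> 1 - (1 - v - \<delta>) * (1 - profile n (c ^ n))"
        using B v cn M(3) unfolding coprism_bound_def M_def by (auto simp: less_imp_le)
      also have "\<dots> \<le> 1 - (1 - v - \<delta>) * (1 - grow n (c ^ n))"
      proof -
        have "profile n (c ^ n) \<le> grow n (c ^ n)" using profile_le_grow[of "c ^ n" "n - 1"] n cn by simp
        then show ?thesis using v mult_left_mono[of "1 - grow n (c ^ n)" "1 - profile n (c ^ n)" "1 - v - \<delta>"] by simp
      qed
      also have "grow n (c ^ n) = (c + \<delta>) ^ n"
        using n c0 by (simp add: grow_def real_root_power_cancel)
      finally show "profile (Suc n) M \<le> 1 - (1 - v - \<delta>) * (1 - (c + \<delta>) ^ n)" .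
    qed (use 4 \<delta>_pos in auto)
    also have "\<dots> = 1 - (1 - v - \<delta>) * (1 - (c + \<delta>) ^ Suc n)"
      by (simp add: algebra_simps)
    also have "\<dots> = coprism_mixed (Suc n) \<alpha> v"
      unfolding mh gr using 4 c0 \<delta>_pos power_le_one[of "c + \<delta>" "Suc n"] by (simp add: min_absorb2 del: power_Suc)
    finally show ?thesis .
  qed
qed

text \<open>
  The mixed values depend continuously on the position of the jump, which ranges over compact
  intervals, so they have a minimum. If it were below the profile, it could be taken as \<open>\<mu>\<close> in the
  two preceding lemmas, and no mixed value could equal it. In the case \<open>n = 0\<close> a box in one
  coordinate is up to reflection also the complement of one, and the mixed sets are pure.
\<close>

lemma mixed_bounds:
  assumes A: "prism_bound n" and B: "coprism_bound n" and \<alpha>: "0 < \<alpha>" "\<alpha> \<le> 1"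
  shows "(\<forall>x. \<alpha> \<le> x \<longrightarrow> x \<le> 1 - \<delta> \<longrightarrow> profile (Suc (Suc n)) \<alpha> \<le> prism_mixed (Suc n) \<alpha> x) \<and>
    (\<forall>y. 0 \<le> y \<longrightarrow> y \<le> \<alpha> \<longrightarrow> y \<le> 1 - \<delta> \<longrightarrow> profile (Suc (Suc n)) \<alpha> \<le> coprism_mixed (Suc n) \<alpha> y)"
proof (cases "n = 0")
  case True
  have 1: "profile 2 \<alpha> \<le> prism_mixed 1 \<alpha> x" if x: "\<alpha> \<le> x" "x \<le> 1 - \<delta>" for x
  proof -
    have x0: "0 < x" using \<alpha> x by simp
    have "profile 2 \<alpha> \<le> x + \<delta>" using profile_le_add[of \<alpha> 1] \<alpha> x by (simp add: numeral_2_eq_2)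
    moreover have "profile 2 \<alpha> \<le> (x + \<delta>) * grow 1 (\<alpha> / x)"
      using grow_prism[of 1 x "\<alpha> / x"] profile_le_grow[of \<alpha> 1] x0 \<alpha> by (simp add: numeral_2_eq_2)
    ultimately show ?thesis
      unfolding prism_mixed_def cogrow_one grow_one by (auto simp: min_def)
  qed
  have 2: "profile 2 \<alpha> \<le> coprism_mixed 1 \<alpha> y" if y: "0 \<le> y" "y \<le> \<alpha>" "y \<le> 1 - \<delta>" for y
  proof -
    define p where "p = (\<alpha> - y) / (1 - y)"
    have y1: "0 < 1 - y" using y \<delta>_pos by simp
    have p: "0 \<le> p" "p \<le> 1" using \<alpha> y y1 by (auto simp: p_def)
    have yp: "(1 - y) * (1 - p) = 1 - \<alpha>" using y1 by (simp add: p_def field_simps)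
    have "profile 2 \<alpha> \<le> cogrow 2 \<alpha>" using profile_le_cogrow[of \<alpha> 1] \<alpha> by (simp add: numeral_2_eq_2)
    also have "\<dots> \<le> 1 - (1 - y - \<delta>) * (1 - cogrow 1 p)"
      using shrink_prism[of 1 "1 - y" "1 - p"] y p unfolding yp by (simp add: cogrow_def numeral_2_eq_2)
    also have "\<dots> = coprism_mixed 1 \<alpha> y"
      unfolding coprism_mixed_def p_def[symmetric] cogrow_one grow_one ..
    finally show ?thesis .
  qed
  show ?thesis using 1 2 True by (simp add: numeral_2_eq_2)
next
  case False
  then have n: "0 < n" by simp
  let ?S = "prism_mixed (Suc n) \<alpha> ` {\<alpha>..1 - \<delta>} \<union> coprism_mixed (Suc n) \<alpha> ` {0..min \<alpha> (1 - \<delta>)}"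
  have "compact ?S"
    using prism_mixed_continuous[of \<alpha> "Suc n"] coprism_mixed_continuous[of \<alpha> "Suc n"] \<alpha>
    by (intro compact_Un compact_continuous_image) auto
  moreover have "coprism_mixed (Suc n) \<alpha> 0 \<in> ?S" using \<alpha> \<delta>_le_1 by auto
  ultimately obtain \<mu> where \<mu>: "\<mu> \<in> ?S" "\<And>z. z \<in> ?S \<Longrightarrow> \<mu> \<le> z"
    using compact_attains_inf[of ?S] by blast
  have low: "\<mu> \<le> prism_mixed (Suc n) \<alpha> x" if "\<alpha> \<le> x" "x \<le> 1 - \<delta>" for x
    using that by (intro \<mu>(2)) auto
  have high: "\<mu> \<le> coprism_mixed (Suc n) \<alpha> y" if "0 \<le> y" "y \<le> \<alpha>" "y \<le> 1 - \<delta>" for y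
    using that by (intro \<mu>(2)) auto
  have "profile (Suc (Suc n)) \<alpha> \<le> \<mu>"
  proof (rule ccontr)
    assume "\<not> profile (Suc (Suc n)) \<alpha> \<le> \<mu>"
    then have lt: "\<mu> < profile (Suc (Suc n)) \<alpha>" by simp
    show False
      using \<mu>(1) prism_mixed_not_minimal[OF A B n \<alpha> low high lt]
        coprism_mixed_not_minimal[OF A B n \<alpha> low high lt] by fastforce
  qed
  then show ?thesis using low high by (meson order_trans)
qed

lemma prism_coprism_bounds: "prism_bound n \<and> coprism_bound n"
proof (induction n)
  case 0
  have "prism_bound 0"
    unfolding prism_bound_def
  proof (intro allI impI)
    fix x p :: real assume xp: "0 < x" "x \<le> 1 - \<delta>" "0 < p" "p \<le> 1"
    have "profile (Suc 0) (x * p) \<le> x * p + \<delta>" using xp by (intro profile_le_add) auto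
    also have "x * p \<le> x" using xp by (simp add: mult_left_le)
    finally show "profile (Suc 0) (x * p) \<le> (x + \<delta>) * profile 0 p" using xp by (simp add: profile_0)
  qed
  moreover have "coprism_bound 0"
    unfolding coprism_bound_def
  proof (intro allI impI)
    fix y p :: real assume yp: "0 \<le> y" "y \<le> 1 - \<delta>" "0 \<le> p" "p \<le> 1" "0 < y + (1 - y) * p"
    show "profile (Suc 0) (y + (1 - y) * p) \<le> 1 - (1 - y - \<delta>) * (1 - profile 0 p)"
    proof (cases "p = 0")
      case True
      then show ?thesis using yp profile_le_add[of y 0] by (simp add: profile_nonpos)
    next
      case False
      then show ?thesis using yp profile_le_1 by (simp add: profile_0)
    qed
  qed
  ultimately show ?case ..
next
  case (Suc n)
  then have A: "prism_bound n" and B: "coprism_bound n" by auto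
  have "prism_bound (Suc n)"
    unfolding prism_bound_def
  proof (intro allI impI)
    fix x p :: real assume xp: "0 < x" "x \<le> 1 - \<delta>" "0 < p" "p \<le> 1"
    have \<alpha>: "0 < x * p" "x * p \<le> 1" "x * p \<le> x" "x * p / x = p"
      using xp \<delta>_pos mult_le_one[of x p] by (auto simp: mult_left_le)
    have "profile (Suc (Suc n)) (x * p) \<le> (x + \<delta>) * profile (Suc n) (x * p / x)"
      by (rule prism_bound_via_mixed[OF A \<alpha>(1,2) order_refl]) (use mixed_bounds[OF A B \<alpha>(1,2)] \<alpha>(3) xp in auto)
    then show "profile (Suc (Suc n)) (x * p) \<le> (x + \<delta>) * profile (Suc n) p" using \<alpha>(4) by simp
  qed
  moreover have "coprism_bound (Suc n)"
    unfolding coprism_bound_def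
  proof (intro allI impI)
    fix y p :: real assume yp: "0 \<le> y" "y \<le> 1 - \<delta>" "0 \<le> p" "p \<le> 1" "0 < y + (1 - y) * p"
    define \<alpha> where "\<alpha> = y + (1 - y) * p"
    have y1: "0 < 1 - y" using yp \<delta>_pos by simp
    have "(1 - y) * p \<le> 1 - y" using yp y1 by (intro mult_left_le) auto
    then have "\<alpha> \<le> 1" unfolding \<alpha>_def by linarith
    then have \<alpha>: "0 < \<alpha>" "\<alpha> \<le> 1" "y \<le> \<alpha>" "(\<alpha> - y) / (1 - y) = p"
      using yp y1 by (auto simp: \<alpha>_def)
    have "profile (Suc (Suc n)) \<alpha> \<le> 1 - (1 - y - \<delta>) * (1 - profile (Suc n) ((\<alpha> - y) / (1 - y)))"
      by (rule coprism_bound_via_mixed[OF B \<alpha>(1,2) order_refl]) (use mixed_bounds[OF A B \<alpha>(1,2)] \<alpha>(3) yp in auto)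
    then show "profile (Suc (Suc n)) (y + (1 - y) * p) \<le> 1 - (1 - y - \<delta>) * (1 - profile (Suc n) p)"
      using \<alpha>(4) by (simp add: \<alpha>_def)
  qed
  ultimately show ?case ..
qed

text \<open>
  The least possible measure of the thickening of a set of measure \<open>e\<close> in \<open>[0,1]\<close>. For \<open>e = 0\<close> it is
  \<open>0\<close> because the set may be empty.
\<close>

definition widen :: "real \<Rightarrow> real"
  where "widen e = (if e \<le> 0 then 0 else min 1 (e + \<delta>))"

text \<open>
  The one-dimensional form of the theorem for a slice function that is the mixture, with weight \<open>s\<close>,
  of the indicator functions of two nested intervals of lengths \<open>x\<close> and \<open>y\<close>. Its neighbourhood has
  full slices on the widened smaller interval and slices with bound \<open>profile n s\<close> on the rest of the
  widened larger one. For \<open>y = 0\<close> the set is a prism. For \<open>y > 0\<close> the estimate is direct if both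
  widened intervals fit into \<open>[0,1]\<close> or both fill it; otherwise the set is compared with the coprism
  that is full on the smaller interval.
\<close>

lemma two_point_bound:
  assumes \<alpha>: "0 < \<alpha>" "\<alpha> \<le> 1" and yx: "0 \<le> y" "y \<le> \<alpha>" "\<alpha> \<le> x" "x \<le> 1"
    and s: "0 \<le> s" "s \<le> 1" "s * x + (1 - s) * y = \<alpha>"
  shows "profile (Suc n) \<alpha> \<le> profile n s * widen x + (1 - profile n s) * widen y"
proof -
  have A: "prism_bound n" and B: "coprism_bound n" using prism_coprism_bounds by auto
  have x0: "0 < x" using \<alpha> yx by simp
  have g: "s \<le> profile n s" "profile n s \<le> 1" "0 \<le> profile n s"
    using profile_ge profile_le_1 profile_nonneg s by auto
  consider "y = 0" "x \<le> 1 - \<delta>" | "y = 0" "1 - \<delta> < x" | "0 < y" "1 - \<delta> < y"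
    | "0 < y" "y \<le> 1 - \<delta>" "x \<le> 1 - \<delta>" | "0 < y" "y \<le> 1 - \<delta>" "1 - \<delta> < x"
    using yx by linarith
  then show ?thesis
  proof cases
    case 1
    then have sx: "x * s = \<alpha>" using s by (simp add: mult.commute)
    then have "0 < s" using \<alpha> x0 zero_less_mult_pos by blast
    then have "profile (Suc n) \<alpha> \<le> (x + \<delta>) * profile n s"
      using A[unfolded prism_bound_def, rule_format, of x s] x0 1 s sx by simp
    then show ?thesis using 1 x0 by (simp add: widen_def mult.commute)
  next
    case 2
    have "\<alpha> = s * x" using s 2 by simp
    also have "\<dots> \<le> s" using yx s by (simp add: mult_left_le)
    finally have "profile (Suc n) \<alpha> \<le> profile n s"
      using profile_mono[of \<alpha> s n] s profile_Suc_le[of n \<alpha>] by linarith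
    then show ?thesis using 2 x0 by (simp add: widen_def)
  next
    case 3
    then have "widen x = 1" "widen y = 1" using yx by (auto simp: widen_def)
    then show ?thesis using profile_le_1 by simp
  next
    case 4
    have "profile (Suc n) \<alpha> \<le> \<alpha> + \<delta>" using profile_le_add \<alpha> by simp
    also have "\<dots> = y + \<delta> + s * (x - y)" using s(3) by (simp add: algebra_simps)
    also have "\<dots> \<le> y + \<delta> + profile n s * (x - y)"
      using g yx by (intro add_left_mono mult_right_mono) auto
    also have "\<dots> = profile n s * widen x + (1 - profile n s) * widen y"
      using 4 x0 by (simp add: widen_def algebra_simps)
    finally show ?thesis .
  next
    case 5
    have y1: "0 < 1 - y" using 5 \<delta>_pos by simp
    define p where "p = (\<alpha> - y) / (1 - y)"
    have p: "0 \<le> p" "p \<le> 1" "y + (1 - y) * p = \<alpha>" using \<alpha> yx y1 by (auto simp: p_def)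
    have "(1 - y) * p = s * (x - y)" using p(3) s(3) by (simp add: algebra_simps)
    also have "\<dots> \<le> s * (1 - y)" using s yx by (intro mult_left_mono) auto
    finally have "p \<le> s" using y1 by (simp add: mult.commute)
    then have ps: "profile n p \<le> profile n s" using profile_mono s by simp
    have "profile (Suc n) \<alpha> \<le> 1 - (1 - y - \<delta>) * (1 - profile n p)"
      using B[unfolded coprism_bound_def, rule_format, of y p] p 5 \<alpha> by simp
    also have "\<dots> \<le> 1 - (1 - y - \<delta>) * (1 - profile n s)"
      using ps 5 mult_left_mono[of "1 - profile n s" "1 - profile n p" "1 - y - \<delta>"] by simp
    also have "\<dots> = profile n s * widen x + (1 - profile n s) * widen y"
      using 5 x0 by (simp add: widen_def algebra_simps)
    finally show ?thesis .
  qed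
qed

end

section \<open>Two-point decompositions and slices of the cube\<close>

text \<open>
  A probability distribution with mean \<open>\<alpha>\<close> is a mixture of distributions on at most two points that
  also have mean \<open>\<alpha>\<close>: the pair \<open>(i, j)\<close>, with \<open>x j < \<alpha> \<le> x i\<close>, gets a weight proportional to
  \<open>w i * w j * (x i - x j)\<close>. If all the mass sits at \<open>\<alpha>\<close> there are no such pairs, and the diagonal
  pairs take their place. The mixture is expressed by its action on test functions \<open>v\<close>.
\<close>

lemma two_point_decomposition:
  fixes w x :: "'j \<Rightarrow> real"
  assumes J: "finite J" and w: "\<And>j. j \<in> J \<Longrightarrow> 0 \<le> w j" "sum w J = 1"
    and mean: "(\<Sum>j\<in>J. w j * x j) = \<alpha>"
  obtains c \<theta> :: "'j \<times> 'j \<Rightarrow> real"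
  where "\<And>p. 0 \<le> c p" "\<And>p. 0 \<le> \<theta> p \<and> \<theta> p \<le> 1"
    "\<And>v. (\<Sum>j\<in>J. w j * v j) = (\<Sum>p\<in>J \<times> J. c p * (\<theta> p * v (fst p) + (1 - \<theta> p) * v (snd p)))"
    "\<And>i j. 0 < c (i, j) \<Longrightarrow> x j \<le> \<alpha> \<and> \<alpha> \<le> x i \<and> (i = j \<or> x j < x i) \<and> \<theta> (i, j) * x i + (1 - \<theta> (i, j)) * x j = \<alpha>"
proof -
  define P where "P = {j \<in> J. \<alpha> \<le> x j}"
  define Q where "Q = {j \<in> J. x j < \<alpha>}"
  have PQ: "P \<union> Q = J" "P \<inter> Q = {}" "finite P" "finite Q"
    using J by (auto simp: P_def Q_def)
  have split: "sum h J = sum h P + sum h Q" for h :: "'j \<Rightarrow> real"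
    using sum.union_disjoint[OF PQ(3,4,2), of h] PQ(1) by simp
  define Z where "Z = (\<Sum>j\<in>Q. w j * (\<alpha> - x j))"
  have ZP: "Z = (\<Sum>i\<in>P. w i * (x i - \<alpha>))"
  proof -
    have "(\<Sum>j\<in>J. w j * (x j - \<alpha>)) = (\<Sum>j\<in>J. w j * x j) - sum w J * \<alpha>"
      by (simp add: algebra_simps sum_subtractf sum_distrib_left)
    then have "(\<Sum>j\<in>J. w j * (x j - \<alpha>)) = 0" using w mean by simp
    moreover have "(\<Sum>j\<in>Q. w j * (x j - \<alpha>)) = - Z"
      by (simp add: Z_def flip: sum_negf) (simp add: algebra_simps)
    ultimately show ?thesis using split[of "\<lambda>j. w j * (x j - \<alpha>)"] by simp
  qed
  have Qt: "0 \<le> w j * (\<alpha> - x j)" if "j \<in> Q" for j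
    using that w by (auto simp: Q_def)
  have Pt: "0 \<le> w i * (x i - \<alpha>)" if "i \<in> P" for i
    using that w by (auto simp: P_def)
  have Z0: "0 \<le> Z" unfolding Z_def using Qt by (rule sum_nonneg)
  show thesis
  proof (cases "Z = 0")
    case True
    have zQ: "\<forall>j\<in>Q. w j * (\<alpha> - x j) = 0"
      using True Qt PQ(4) unfolding Z_def by (subst (asm) sum_nonneg_eq_0_iff) auto
    have zP: "\<forall>i\<in>P. w i * (x i - \<alpha>) = 0"
      using True Pt PQ(3) unfolding ZP by (subst (asm) sum_nonneg_eq_0_iff) auto
    have "w j = 0 \<or> x j = \<alpha>" if jJ: "j \<in> J" for j
    proof -
      consider "j \<in> P" | "j \<in> Q" using jJ PQ(1) by blast
      then show ?thesis
        using zP zQ by cases force+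
    qed
    then have x\<alpha>: "x j = \<alpha>" if "j \<in> J" "0 < w j" for j using that by force
    define c where "c = (\<lambda>(i, j). if i = j \<and> i \<in> J then w i else 0)"
    show thesis
    proof (rule that[of c "\<lambda>_. 1"])
      fix v :: "'j \<Rightarrow> real"
      have "(\<Sum>p\<in>J \<times> J. c p * (1 * v (fst p) + (1 - 1) * v (snd p))) =
          (\<Sum>i\<in>J. \<Sum>j\<in>J. if i = j then w i * v i else 0)"
        by (auto simp: sum.cartesian_product c_def intro!: sum.cong)
      also have "\<dots> = (\<Sum>j\<in>J. w j * v j)" using J by simp
      finally show "(\<Sum>j\<in>J. w j * v j) = (\<Sum>p\<in>J \<times> J. c p * (1 * v (fst p) + (1 - 1) * v (snd p)))" ..
    qed (use w x\<alpha> in \<open>auto simp: c_def split: if_splits\<close>)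
  next
    case False
    then have Zp: "0 < Z" using Z0 by simp
    define c where "c = (\<lambda>(i, j). if i \<in> P \<and> j \<in> Q then w i * w j * (x i - x j) / Z else 0)"
    define \<theta> where "\<theta> = (\<lambda>(i, j). if i \<in> P \<and> j \<in> Q then (\<alpha> - x j) / (x i - x j) else 0)"
    have gap: "x j < \<alpha> \<and> \<alpha> \<le> x i" if "i \<in> P" "j \<in> Q" for i j
      using that by (auto simp: P_def Q_def)
    show thesis
    proof (rule that[of c \<theta>])
      show "0 \<le> c p" for p
        using w gap Zp by (cases p) (fastforce simp: c_def P_def Q_def intro!: divide_nonneg_pos mult_nonneg_nonneg)
      show "0 \<le> \<theta> p \<and> \<theta> p \<le> 1" for p
        using gap by (cases p) (fastforce simp: \<theta>_def divide_simps)
      show "x j \<le> \<alpha> \<and> \<alpha> \<le> x i \<and> (i = j \<or> x j < x i) \<and> \<theta> (i, j) * x i + (1 - \<theta> (i, j)) * x j = \<alpha>"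
        if "0 < c (i, j)" for i j
      proof -
        have ij: "i \<in> P" "j \<in> Q" using that by (auto simp: c_def split: if_splits)
        have "\<theta> (i, j) * (x i - x j) = \<alpha> - x j" using ij gap[OF ij] by (simp add: \<theta>_def)
        then show ?thesis using gap[OF ij] by (auto simp: algebra_simps)
      qed
      fix v :: "'j \<Rightarrow> real"
      have summand: "c (i, j) * (\<theta> (i, j) * v i + (1 - \<theta> (i, j)) * v j) =
          w i * v i / Z * (w j * (\<alpha> - x j)) + w i * (x i - \<alpha>) * (w j * v j / Z)"
        if ij: "i \<in> P" "j \<in> Q" for i j
      proof -
        have d: "\<theta> (i, j) * (x i - x j) = \<alpha> - x j" "(1 - \<theta> (i, j)) * (x i - x j) = x i - \<alpha>"
          using ij gap[OF ij] by (auto simp: \<theta>_def field_simps)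
        have "c (i, j) * (\<theta> (i, j) * v i + (1 - \<theta> (i, j)) * v j) =
            w i * w j / Z * ((\<theta> (i, j) * (x i - x j)) * v i + ((1 - \<theta> (i, j)) * (x i - x j)) * v j)"
        proof -
          have "q * g * (t * A + (1 - t) * B) = q * ((t * g) * A + ((1 - t) * g) * B)"
            for q g t A B :: real by (simp add: algebra_simps)
          moreover have "c (i, j) = w i * w j / Z * (x i - x j)" using ij by (simp add: c_def)
          ultimately show ?thesis by simp
        qed
        also have "\<dots> = w i * v i / Z * (w j * (\<alpha> - x j)) + w i * (x i - \<alpha>) * (w j * v j / Z)"
          unfolding d by (simp add: distrib_left mult_ac)
        finally show ?thesis .
      qed
      have "(\<Sum>p\<in>J \<times> J. c p * (\<theta> p * v (fst p) + (1 - \<theta> p) * v (snd p))) =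
          (\<Sum>p\<in>P \<times> Q. c p * (\<theta> p * v (fst p) + (1 - \<theta> p) * v (snd p)))"
        using J by (intro sum.mono_neutral_right) (auto simp: c_def P_def Q_def split: if_splits)
      also have "\<dots> = (\<Sum>i\<in>P. \<Sum>j\<in>Q. c (i, j) * (\<theta> (i, j) * v i + (1 - \<theta> (i, j)) * v j))"
        by (simp add: sum.cartesian_product case_prod_unfold)
      also have "\<dots> = (\<Sum>i\<in>P. \<Sum>j\<in>Q. w i * v i / Z * (w j * (\<alpha> - x j)) + w i * (x i - \<alpha>) * (w j * v j / Z))"
        using summand by simp
      also have "\<dots> = (\<Sum>i\<in>P. w i * v i / Z) * Z + Z * (\<Sum>j\<in>Q. w j * v j / Z)"
        unfolding sum.distrib sum_product[symmetric] Z_def[symmetric] ZP[symmetric] ..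
      also have "\<dots> = sum (\<lambda>j. w j * v j) P + sum (\<lambda>j. w j * v j) Q"
        using Zp by (simp add: sum_divide_distrib[symmetric])
      also have "\<dots> = (\<Sum>j\<in>J. w j * v j)" by (rule split[symmetric])
      finally show "(\<Sum>j\<in>J. w j * v j) = (\<Sum>p\<in>J \<times> J. c p * (\<theta> p * v (fst p) + (1 - \<theta> p) * v (snd p)))" ..
    qed
  qed
qed

lemma fmeasurable_unit_interval:
  fixes E :: "real set"
  assumes "E \<in> sets borel" "E \<subseteq> {0..1}"
  shows "E \<in> fmeasurable lborel"
proof (rule fmeasurableI2)
  show "{0..1::real} \<in> fmeasurable lborel" by (simp add: fmeasurable_def)
qed (use assms in auto)

lemma slice_subset_cube:
  fixes X :: "('i \<Rightarrow> real) set"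
  assumes "i \<notin> I" "X \<subseteq> (\<Pi>\<^sub>E j\<in>insert i I. {0..1})"
  shows "{x \<in> space (PiM I (\<lambda>_. lborel)). x(i := s) \<in> X} \<subseteq> (\<Pi>\<^sub>E j\<in>I. {0..1})"
proof
  fix x assume x: "x \<in> {x \<in> space (PiM I (\<lambda>_. lborel)). x(i := s) \<in> X}"
  then have "x(i := s) \<in> (\<Pi>\<^sub>E j\<in>insert i I. {0..1})" using assms(2) by auto
  then have "x j \<in> {0..1}" if "j \<in> I" for j
    using that assms(1) by (metis PiE_mem fun_upd_other insertI2)
  then show "x \<in> (\<Pi>\<^sub>E j\<in>I. {0..1})"
    using x by (auto simp: space_PiM PiE_iff)
qed

text \<open>
  Fubini for subsets of the cube, with real-valued slice measures.
\<close>

lemma cube_slices: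
  fixes I :: "'i set" and i :: 'i and X :: "('i \<Rightarrow> real) set"
  defines "N \<equiv> PiM I (\<lambda>_. lborel :: real measure)"
  defines "f \<equiv> (\<lambda>s. measure N {x \<in> space N. x(i := s) \<in> X})"
  assumes I: "finite I" "i \<notin> I"
    and X: "X \<in> sets (PiM (insert i I) (\<lambda>_. lborel))" "X \<subseteq> (\<Pi>\<^sub>E j\<in>insert i I. {0..1})"
  shows "{x \<in> space N. x(i := s) \<in> X} \<in> sets N"
    and "f \<in> borel_measurable borel" and "0 \<le> f s" and "f s \<le> 1" and "s \<notin> {0..1} \<Longrightarrow> f s = 0"
    and "integrable lborel f" and "integral\<^sup>L lborel f = measure (PiM (insert i I) (\<lambda>_. lborel)) X"
proof -
  interpret product_sigma_finite "\<lambda>_::'i. lborel :: real measure" by standard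
  interpret IN: finite_product_sigma_finite "\<lambda>_::'i. lborel :: real measure" I
    by standard (rule I(1))
  let ?M = "PiM (insert i I) (\<lambda>_. lborel :: real measure)"
  have Xm[measurable]: "X \<in> sets ?M" by (rule X(1))
  have upd[measurable]: "(\<lambda>(s, x). x(i := s)) \<in> lborel \<Otimes>\<^sub>M N \<rightarrow>\<^sub>M ?M"
    unfolding N_def case_prod_unfold
    by (rule measurable_fun_upd[where J = I]) auto
  have updat: "(\<lambda>x. x(i := s)) \<in> N \<rightarrow>\<^sub>M ?M" for s
    using measurable_compose[OF measurable_Pair1' upd, of s] by (simp add: case_prod_unfold)
  show sl: "{x \<in> space N. x(i := s) \<in> X} \<in> sets N" for s
    using measurable_sets[OF updat X(1), of s] by (simp add: vimage_def Int_def conj_commute)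
  have sub: "{x \<in> space N. x(i := s) \<in> X} \<subseteq> (\<Pi>\<^sub>E j\<in>I. {0..1})" for s
    unfolding N_def using I(2) X(2) by (rule slice_subset_cube)
  have "emeasure N (\<Pi>\<^sub>E j\<in>I. {0..1}) = 1"
    unfolding N_def by (subst emeasure_PiM) (auto simp: I)
  moreover have "(\<Pi>\<^sub>E j\<in>I. {0..1}) \<in> sets N"
    unfolding N_def using I by (intro sets_PiM_I_finite) auto
  note emeasure_mono[OF sub this]
  ultimately have le1: "emeasure N {x \<in> space N. x(i := s) \<in> X} \<le> 1" for s
    by (simp only:)
  have fe: "emeasure N {x \<in> space N. x(i := s) \<in> X} = ennreal (f s)" for s
    unfolding f_def using le1[of s] by (intro emeasure_eq_ennreal_measure) (auto simp: top_unique)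
  show f0: "0 \<le> f s" for s by (simp add: f_def)
  show "f s \<le> 1" for s
  proof -
    have "ennreal (f s) \<le> ennreal 1" using le1[of s] unfolding fe by simp
    then show ?thesis by (subst (asm) ennreal_le_iff) auto
  qed
  show "f s = 0" if "s \<notin> {0..1}"
  proof -
    have "x(i := s) \<notin> X" for x
      using X(2) that by (metis PiE_mem fun_upd_same insertI1 subsetD)
    then show ?thesis by (simp add: f_def)
  qed
  have e: "(\<integral>\<^sup>+ x. indicator X (x(i := s)) \<partial>N) = ennreal (f s)" for s
  proof -
    have "(\<integral>\<^sup>+ x. indicator X (x(i := s)) \<partial>N) = (\<integral>\<^sup>+ x. indicator {x \<in> space N. x(i := s) \<in> X} x \<partial>N)"
      by (intro nn_integral_cong) (auto simp: indicator_def)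
    then show ?thesis using sl fe by simp
  qed
  have "sigma_finite_measure N" unfolding N_def by (rule IN.sigma_finite_measure_axioms)
  have "(\<lambda>(s, x). indicator X (x(i := s)) :: ennreal) \<in> borel_measurable (lborel \<Otimes>\<^sub>M N)"
    using measurable_compose[OF upd, of "indicator X :: _ \<Rightarrow> ennreal"] by (simp add: case_prod_unfold)
  then have "(\<lambda>s. \<integral>\<^sup>+ x. indicator X (x(i := s)) \<partial>N) \<in> borel_measurable lborel"
    by (rule sigma_finite_measure.borel_measurable_nn_integral[OF \<open>sigma_finite_measure N\<close>])
  then have "(\<lambda>s. ennreal (f s)) \<in> borel_measurable lborel" unfolding e .
  then have "(\<lambda>s. enn2real (ennreal (f s))) \<in> borel_measurable lborel" by (rule measurable_compose) simp
  then show fm: "f \<in> borel_measurable borel" using f0 by simp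
  have tot: "emeasure ?M X = (\<integral>\<^sup>+ s. ennreal (f s) \<partial>lborel)"
    using product_nn_integral_insert_rev[OF I, of "indicator X"] unfolding N_def[symmetric] e by simp
  have "emeasure ?M X \<le> emeasure ?M (\<Pi>\<^sub>E j\<in>insert i I. {0..1})"
    using X(2) I by (intro emeasure_mono sets_PiM_I_finite) auto
  also have "\<dots> = 1" by (subst emeasure_PiM) (auto simp: I)
  finally have fin: "emeasure ?M X < \<infinity>" by (simp add: le_less_trans)
  show "integrable lborel f"
    using fm f0 fin unfolding tot by (intro integrableI_nonneg) auto
  show "integral\<^sup>L lborel f = measure ?M X"
    using fm f0 by (subst integral_eq_nn_integral) (auto simp: measure_def tot)
qed

context enlargement
begin

section \<open>Thickened superlevel sets of the slice measure\<close>

definition thicken :: "real set \<Rightarrow> real set"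
  where "thicken E = {s \<in> {0..1}. \<exists>e\<in>E. \<bar>s - e\<bar> < \<delta>}"

lemma thicken_mono: "E \<subseteq> F \<Longrightarrow> thicken E \<subseteq> thicken F"
  by (auto simp: thicken_def)

lemma thicken_borel [measurable]: "thicken E \<in> sets borel"
proof -
  have "thicken E = {0..1} \<inter> (\<Union>e\<in>E. ball e \<delta>)"
    by (auto simp: thicken_def dist_real_def abs_minus_commute)
  moreover have "open (\<Union>e\<in>E. ball e \<delta>)" by (intro open_UN) auto
  ultimately show ?thesis by (metis borel_closed borel_open closed_atLeastAtMost sets.Int)
qed

lemma thicken_fmeasurable: "thicken E \<in> fmeasurable lborel"
  by (rule fmeasurable_unit_interval[OF thicken_borel]) (auto simp: thicken_def)

text \<open>
  If some \<open>z\<close> is missed by the thickening, \<open>E\<close> has no points within distance \<open>\<delta>\<close> of \<open>z\<close>. The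
  interval of length \<open>\<delta>\<close> next to the last point of \<open>E\<close> before \<open>z\<close>, or to the first one after \<open>z\<close>,
  then lies in the thickening but outside \<open>E\<close>.
\<close>

lemma widen_measure_le_thicken:
  assumes E: "E \<in> sets borel" "E \<subseteq> {0..1}"
  shows "widen (measure lborel E) \<le> measure lborel (thicken E)"
proof (cases "measure lborel E \<le> 0")
  case True
  then show ?thesis by (simp add: widen_def)
next
  case False
  then have ne: "E \<noteq> {}" by auto
  have Ef: "E \<in> fmeasurable lborel"
    using E by (intro fmeasurable_unit_interval)
  have sub: "E \<subseteq> thicken E"
  proof
    fix e assume "e \<in> E"
    then show "e \<in> thicken E" using E(2) \<delta>_pos by (auto simp: thicken_def intro!: bexI[of _ e])
  qed
  have gapped: "measure lborel E + \<delta> \<le> measure lborel (thicken E)"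
    if "{b<..<b + \<delta>} \<subseteq> thicken E" "{b<..<b + \<delta>} \<inter> E = {}" for b
  proof -
    have "measure lborel E + \<delta> = measure lborel (E \<union> {b<..<b + \<delta>})"
      using that Ef E \<delta>_pos by (subst measure_Un3) (auto simp: Int_commute fmeasurable_def)
    also have "\<dots> \<le> measure lborel (thicken E)"
      using that sub E by (intro measure_mono_fmeasurable thicken_fmeasurable) auto
    finally show ?thesis .
  qed
  show ?thesis
  proof (cases "thicken E = {0..1}")
    case True
    then show ?thesis using False by (simp add: widen_def)
  next
    case neq: False
    moreover have "thicken E \<subseteq> {0..1}" by (auto simp: thicken_def)
    ultimately obtain z where z: "z \<in> {0..1}" "z \<notin> thicken E" by blast
    then have far: "\<delta> \<le> \<bar>z - e\<bar>" if "e \<in> E" for e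
      using that by (force simp: thicken_def)
    have "measure lborel E + \<delta> \<le> measure lborel (thicken E)"
    proof (cases "E \<inter> {..z} = {}")
      case False
      define b where "b = Sup (E \<inter> {..z})"
      have bdd: "bdd_above (E \<inter> {..z})" by (rule bdd_aboveI[of _ z]) auto
      have bz: "b \<le> z - \<delta>" unfolding b_def using False far by (intro cSup_least) fastforce+
      have bub: "e \<le> b" if "e \<in> E" "e \<le> z" for e
        unfolding b_def using that bdd by (intro cSup_upper) auto
      have b0: "0 \<le> b" using False bub E(2) by fastforce
      \<comment> \<open>the interval to the right of the last point of \<open>E\<close> before \<open>z\<close>\<close>
      show ?thesis
      proof (rule gapped)
        show "{b<..<b + \<delta>} \<subseteq> thicken E"
        proof
          fix s assume s: "s \<in> {b<..<b + \<delta>}"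
          then have "s - \<delta> < Sup (E \<inter> {..z})" by (simp add: b_def[symmetric])
          then obtain e where e: "e \<in> E" "e \<le> z" "s - \<delta> < e" using less_cSupD[OF False] by fastforce
          moreover have "e \<le> b" using bub e by simp
          ultimately show "s \<in> thicken E" using s bz b0 z by (auto simp: thicken_def intro!: bexI[of _ e])
        qed
        show "{b<..<b + \<delta>} \<inter> E = {}"
        proof (intro equals0I)
          fix s assume s: "s \<in> {b<..<b + \<delta>} \<inter> E"
          then have "s \<le> z" using bz by auto
          then have "s \<le> b" using bub s by auto
          then show False using s by auto
        qed
      qed
    next
      case True
      define b where "b = Inf E"
      have gt: "z + \<delta> \<le> e" if "e \<in> E" for e using far[OF that] True that \<delta>_pos by (cases "e \<le> z") auto
      have bdd: "bdd_below E" using gt by (rule bdd_belowI)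
      have bz: "z + \<delta> \<le> b" unfolding b_def using ne gt by (intro cInf_greatest)
      have blb: "b \<le> e" if "e \<in> E" for e
        unfolding b_def using that bdd by (intro cInf_lower)
      have b1: "b \<le> 1" using ne blb E(2) by fastforce
      \<comment> \<open>the interval to the left of the first point of \<open>E\<close> after \<open>z\<close>\<close>
      show ?thesis
      proof (rule gapped[of "b - \<delta>"])
        show "{b - \<delta><..<b - \<delta> + \<delta>} \<subseteq> thicken E"
        proof
          fix s assume s: "s \<in> {b - \<delta><..<b - \<delta> + \<delta>}"
          then have "Inf E < s + \<delta>" by (simp add: b_def[symmetric])
          then obtain e where e: "e \<in> E" "e < s + \<delta>" using cInf_lessD[OF ne] by blast
          moreover have "b \<le> e" using blb e by simp
          ultimately show "s \<in> thicken E" using s bz b1 z by (auto simp: thicken_def intro!: bexI[of _ e])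
        qed
        show "{b - \<delta><..<b - \<delta> + \<delta>} \<inter> E = {}" using blb by fastforce
      qed
    qed
    then show ?thesis using False by (simp add: widen_def)
  qed
qed

lemma profile_indicator_pair:
  assumes "Y \<subseteq> X"
  shows "profile n (\<theta> * indicator X s + (1 - \<theta>) * indicator Y s) =
    profile n \<theta> * indicator X s + (1 - profile n \<theta>) * indicator Y s"
  using assms by (auto simp: indicator_def profile_one profile_nonpos)

text \<open>
  Jensen's inequality, applied to the decomposition into two-point distributions, reduces the
  uniform mixture of the sets \<open>E j\<close> to mixtures of two nested sets, which \<open>two_point_bound\<close> handles.
  Here \<open>E j\<close> is an already thickened set and \<open>x j\<close> the measure before thickening.
\<close>

lemma mixture_integral_bound:
  fixes E :: "'j \<Rightarrow> real set" and b :: "real \<Rightarrow> real"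
  assumes J: "finite J" "J \<noteq> {}"
    and E: "\<And>j. j \<in> J \<Longrightarrow> E j \<in> fmeasurable lborel"
    and x: "\<And>j. j \<in> J \<Longrightarrow> 0 \<le> x j" "\<And>j. j \<in> J \<Longrightarrow> x j \<le> 1"
    and E_ge: "\<And>j. j \<in> J \<Longrightarrow> widen (x j) \<le> measure lborel (E j)"
    and nested: "\<And>i j. \<lbrakk>i \<in> J; j \<in> J; x j < x i\<rbrakk> \<Longrightarrow> E j \<subseteq> E i"
    and b: "integrable lborel b"
    and b_ge: "\<And>s. profile n ((\<Sum>j\<in>J. indicator (E j) s) / card J) \<le> b s"
    and \<alpha>: "\<alpha> = (\<Sum>j\<in>J. x j) / card J" "0 < \<alpha>"
  shows "profile (Suc n) \<alpha> \<le> integral\<^sup>L lborel b"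
proof -
  define w :: "'j \<Rightarrow> real" where "w = (\<lambda>_. 1 / card J)"
  have w: "\<And>j. 0 \<le> w j" "sum w J = 1" "(\<Sum>j\<in>J. w j * x j) = \<alpha>"
    using J \<alpha> by (auto simp: w_def sum_divide_distrib)
  obtain c \<theta> :: "'j \<times> 'j \<Rightarrow> real"
    where c: "\<And>p. 0 \<le> c p" and \<theta>: "\<And>p. 0 \<le> \<theta> p \<and> \<theta> p \<le> 1"
      and decomp: "\<And>v. (\<Sum>j\<in>J. w j * v j) = (\<Sum>p\<in>J \<times> J. c p * (\<theta> p * v (fst p) + (1 - \<theta> p) * v (snd p)))"
      and pair: "\<And>i j. 0 < c (i, j) \<Longrightarrow> x j \<le> \<alpha> \<and> \<alpha> \<le> x i \<and> (i = j \<or> x j < x i)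
        \<and> \<theta> (i, j) * x i + (1 - \<theta> (i, j)) * x j = \<alpha>"
    by (rule two_point_decomposition[OF J(1) w]) (rule that)
  have c1: "sum c (J \<times> J) = 1" using decomp[of "\<lambda>_. 1"] w by simp
  have \<alpha>1: "\<alpha> \<le> 1"
  proof -
    have "(\<Sum>j\<in>J. x j) \<le> (\<Sum>j\<in>J. 1)" using x by (intro sum_mono)
    then show ?thesis using J by (simp add: \<alpha>(1) divide_le_eq_1 card_gt_0_iff)
  qed
  \<comment> \<open>the contribution of the pair \<open>p\<close> to the lower bound for \<open>b\<close>\<close>
  define h where "h p s = c p * (profile n (\<theta> p) * indicator (E (fst p)) s
    + (1 - profile n (\<theta> p)) * indicator (E (snd p)) s)" for p and s :: real
  have hb: "(\<Sum>p\<in>J \<times> J. h p s) \<le> b s" for s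
  proof -
    let ?v = "\<lambda>p. \<theta> p * indicator (E (fst p)) s + (1 - \<theta> p) * indicator (E (snd p)) s"
    have v01: "?v p \<in> {0..1}" for p
      using \<theta>[of p] by (auto simp: indicator_def)
    have "(\<Sum>p\<in>J \<times> J. h p s) \<le> (\<Sum>p\<in>J \<times> J. c p * profile n (?v p))"
    proof (rule sum_mono)
      fix p assume p: "p \<in> J \<times> J"
      show "h p s \<le> c p * profile n (?v p)"
      proof (cases "c p = 0")
        case False
        then have "0 < c p" using c[of p] by simp
        then have "fst p = snd p \<or> x (snd p) < x (fst p)" using pair[of "fst p" "snd p"] by simp
        then have "E (snd p) \<subseteq> E (fst p)" using nested[of "fst p" "snd p"] p by auto
        from profile_indicator_pair[OF this] show ?thesis by (simp add: h_def)
      qed (simp add: h_def)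
    qed
    also have "\<dots> \<le> profile n (\<Sum>p\<in>J \<times> J. c p *\<^sub>R ?v p)"
      using convex_on_sum[OF _ _ profile_convex_on[of n] c1, of ?v] J c v01
      by (simp add: sum_negf)
    also have "(\<Sum>p\<in>J \<times> J. c p *\<^sub>R ?v p) = (\<Sum>j\<in>J. indicator (E j) s) / card J"
      using decomp[of "\<lambda>j. indicator (E j) s"] by (simp add: w_def sum_divide_distrib)
    finally show ?thesis using b_ge[of s] by linarith
  qed
  have int_ind: "integrable lborel (indicator (E j) :: real \<Rightarrow> real)" if "j \<in> J" for j
    using E[OF that] by (auto simp: fmeasurable_def)
  have int_h: "integrable lborel (h p)" if "p \<in> J \<times> J" for p
    unfolding h_def[abs_def] using that int_ind by (intro integrable_mult_right integrable_add) auto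
  have h_int: "integral\<^sup>L lborel (h p) = c p * (profile n (\<theta> p) * measure lborel (E (fst p))
    + (1 - profile n (\<theta> p)) * measure lborel (E (snd p)))" if "p \<in> J \<times> J" for p
    unfolding h_def[abs_def] using that int_ind by (subst integral_mult_right_zero) auto
  have "profile (Suc n) \<alpha> = (\<Sum>p\<in>J \<times> J. c p * profile (Suc n) \<alpha>)"
    using c1 by (simp flip: sum_distrib_right)
  also have "\<dots> \<le> (\<Sum>p\<in>J \<times> J. integral\<^sup>L lborel (h p))"
  proof (rule sum_mono)
    fix p assume p: "p \<in> J \<times> J"
    obtain i j where ij: "p = (i, j)" "i \<in> J" "j \<in> J" using p by auto
    show "c p * profile (Suc n) \<alpha> \<le> integral\<^sup>L lborel (h p)"
    proof (cases "c p = 0")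
      case False
      then have pr: "x j \<le> \<alpha>" "\<alpha> \<le> x i" "\<theta> p * x i + (1 - \<theta> p) * x j = \<alpha>"
        using pair[of i j] c[of p] ij by auto
      have "profile (Suc n) \<alpha> \<le> profile n (\<theta> p) * widen (x i) + (1 - profile n (\<theta> p)) * widen (x j)"
        using two_point_bound[of \<alpha> "x j" "x i" "\<theta> p" n] pr \<alpha> \<alpha>1 x ij \<theta> by auto
      also have "\<dots> \<le> profile n (\<theta> p) * measure lborel (E i) + (1 - profile n (\<theta> p)) * measure lborel (E j)"
        using E_ge ij profile_nonneg[of "\<theta> p" n] profile_le_1[of n "\<theta> p"] \<theta>
        by (intro add_mono mult_left_mono) auto
      finally show ?thesis using c[of p] p ij by (simp add: h_int mult_left_mono)
    qed (simp add: h_def[abs_def])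
  qed
  also have "\<dots> = integral\<^sup>L lborel (\<lambda>s. \<Sum>p\<in>J \<times> J. h p s)"
    using int_h by (subst Bochner_Integration.integral_sum) auto
  also have "\<dots> \<le> integral\<^sup>L lborel b"
    using int_h b hb by (intro integral_mono) auto
  finally show ?thesis .
qed

text \<open>
  Up to an error of \<open>1 / k\<close> the function \<open>f\<close> is the uniform mixture of the indicator functions of
  its superlevel sets at the heights \<open>j / k\<close>. At a point that lies in the thickenings of \<open>q\<close> of
  these sets, \<open>b\<close> is at least \<open>profile n (q / k)\<close>, because the \<open>q\<close>-th or a higher superlevel set
  comes \<open>\<delta>\<close>-near.
\<close>

lemma layered_bound:
  fixes f b :: "real \<Rightarrow> real"
  assumes f: "f \<in> borel_measurable borel" "\<And>s. 0 \<le> f s" "\<And>s. f s \<le> 1" "\<And>s. s \<notin> {0..1} \<Longrightarrow> f s = 0"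
    and f_int: "integrable lborel f" "integral\<^sup>L lborel f = \<alpha>"
    and b: "integrable lborel b" "\<And>s. 0 \<le> b s"
    and fb: "\<And>s e. \<lbrakk>s \<in> {0..1}; \<bar>s - e\<bar> < \<delta>\<rbrakk> \<Longrightarrow> profile n (f e) \<le> b s"
    and k: "0 < k"
  shows "profile (Suc n) (\<alpha> - 1 / real k) \<le> integral\<^sup>L lborel b"
proof -
  define J where "J = {1..k}"
  define E where "E j = {s. real j / k \<le> f s}" for j
  have J: "finite J" "J \<noteq> {}" "card J = k" using k by (auto simp: J_def)
  have Eb: "E j \<in> sets borel" for j
    unfolding E_def using f(1) by measurable
  have E01: "E j \<subseteq> {0..1}" if "j \<in> J" for j
  proof
    fix s assume "s \<in> E j"
    then have "0 < f s" using that k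
      by (auto simp: E_def J_def intro: less_le_trans[of _ "real j / k"])
    then show "s \<in> {0..1}" using f(4)[of s] by force
  qed
  have Ef: "E j \<in> fmeasurable lborel" if "j \<in> J" for j
    using E01[OF that] Eb by (intro fmeasurable_unit_interval)
  define x where "x j = measure lborel (E j)" for j
  have x01: "0 \<le> x j" "x j \<le> 1" if "j \<in> J" for j
  proof -
    have "x j \<le> measure lborel {0..1::real}"
      unfolding x_def using E01[OF that] Eb by (intro measure_mono_fmeasurable fmeasurable_unit_interval) auto
    then show "0 \<le> x j" "x j \<le> 1" by (auto simp: x_def)
  qed
  define \<beta> where "\<beta> = (\<Sum>j\<in>J. x j) / k"
  have ind_int: "integrable lborel (indicator (E j) :: real \<Rightarrow> real)" if "j \<in> J" for j
    using Ef[OF that] by (auto simp: fmeasurable_def)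
  have layer: "f s \<le> (\<Sum>j\<in>J. indicator (E j) s) / k + 1 / k * indicator {0..1} s" for s
  proof (cases "s \<in> {0..1}")
    case True
    define q where "q = nat \<lfloor>k * f s\<rfloor>"
    have kf: "0 \<le> k * f s" "k * f s \<le> k" using f(2,3)[of s] by (auto simp: mult_left_le)
    have q: "real q \<le> k * f s" "k * f s < real q + 1"
      using kf by (auto simp: q_def)
    have "q \<le> k" using q kf by linarith
    have "real q = (\<Sum>j\<in>{1..q}. 1)" by simp
    also have "\<dots> \<le> (\<Sum>j\<in>{1..q}. indicator (E j) s)"
    proof (rule sum_mono)
      fix j assume "j \<in> {1..q}"
      then have "real j \<le> k * f s" using q by simp
      then have "s \<in> E j" using k by (simp add: E_def divide_le_eq mult.commute)
      then show "(1::real) \<le> indicator (E j) s" by simp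
    qed
    also have "\<dots> \<le> (\<Sum>j\<in>J. indicator (E j) s)"
      using \<open>q \<le> k\<close> by (intro sum_mono2) (auto simp: J_def)
    finally have "f s * k \<le> (\<Sum>j\<in>J. indicator (E j) s) + 1" using q by (simp add: mult.commute)
    then show ?thesis using k True by (simp add: field_simps)
  next
    case False
    then show ?thesis using f(4)[of s] by (auto intro!: divide_nonneg_nonneg sum_nonneg)
  qed
  have "\<alpha> \<le> integral\<^sup>L lborel (\<lambda>s. (\<Sum>j\<in>J. indicator (E j) s) / k + 1 / k * indicator {0..1} s)"
    unfolding f_int(2)[symmetric] using ind_int f_int(1) layer
    by (intro integral_mono) auto
  also have "\<dots> = \<beta> + 1 / k"
    using ind_int by (simp add: \<beta>_def x_def Bochner_Integration.integral_sum)
  finally have \<alpha>\<beta>: "\<alpha> - 1 / k \<le> \<beta>" by simp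
  show ?thesis
  proof (cases "\<beta> \<le> 0")
    case True
    then have "profile (Suc n) (\<alpha> - 1 / k) = 0" using \<alpha>\<beta> by (intro profile_nonpos) simp
    then show ?thesis using b(2) by simp
  next
    case False
    have "(\<Sum>j\<in>J. x j) \<le> (\<Sum>j\<in>J. 1)" using x01 by (intro sum_mono)
    then have \<beta>1: "\<beta> \<le> 1" using J k by (simp add: \<beta>_def)
    have anti: "E j \<subseteq> E i" if "i \<le> j" for i j
    proof -
      have "real i / k \<le> real j / k" using that by (simp add: divide_right_mono)
      then show ?thesis unfolding E_def by (auto intro: order_trans)
    qed
    have "profile (Suc n) \<beta> \<le> integral\<^sup>L lborel b"
    proof (rule mixture_integral_bound[where J = J and E = "\<lambda>j. thicken (E j)" and x = x])
      show "widen (x j) \<le> measure lborel (thicken (E j))" if "j \<in> J" for j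
        unfolding x_def using E01[OF that] Eb by (intro widen_measure_le_thicken)
      show "thicken (E j) \<subseteq> thicken (E i)" if ij: "i \<in> J" "j \<in> J" "x j < x i" for i j
      proof (cases "i \<le> j")
        case False
        then have "x i \<le> x j" unfolding x_def
          using anti[of j i] Eb Ef ij by (intro measure_mono_fmeasurable) auto
        then show ?thesis using ij by simp
      qed (use anti thicken_mono in blast)
      show "profile n ((\<Sum>j\<in>J. indicator (thicken (E j)) s) / card J) \<le> b s" for s
      proof (cases "\<exists>j\<in>J. s \<in> thicken (E j)")
        case True
        define S where "S = {j \<in> J. s \<in> thicken (E j)}"
        have S: "finite S" "S \<noteq> {}" using True J by (auto simp: S_def)
        define q where "q = Max S"
        have q: "q \<in> S" "\<And>j. j \<in> S \<Longrightarrow> j \<le> q" using S by (auto simp: q_def)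
        then obtain e where e: "e \<in> E q" "\<bar>s - e\<bar> < \<delta>" "s \<in> {0..1}"
          by (auto simp: S_def thicken_def)
        have "(\<Sum>j\<in>J. indicator (thicken (E j)) s) = real (card S)"
          using J by (simp add: S_def indicator_def sum.If_cases Int_def)
        also have "card S \<le> card {1..q}" using q(2) by (intro card_mono) (auto simp: S_def J_def)
        finally have "(\<Sum>j\<in>J. indicator (thicken (E j)) s) / real (card J) \<le> real q / k"
          using J by (simp add: divide_right_mono)
        also have "\<dots> \<le> f e" using e by (simp add: E_def)
        finally have "profile n ((\<Sum>j\<in>J. indicator (thicken (E j)) s) / card J) \<le> profile n (f e)"
          using f(3) by (intro profile_mono)
        then show ?thesis using fb[of s e] e by linarith
      next
        case False
        then have "(\<Sum>j\<in>J. indicator (thicken (E j)) s :: real) = 0" by (auto simp: indicator_def)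
        then show ?thesis using b(2) by (simp add: profile_nonpos)
      qed
    qed (use J x01 b thicken_fmeasurable False in \<open>auto simp: \<beta>_def\<close>)
    then show ?thesis using profile_mono[OF \<alpha>\<beta> \<beta>1, of "Suc n"] by simp
  qed
qed

lemma profile_limit:
  assumes \<alpha>: "\<alpha> \<le> 1" and bound: "\<And>k::nat. 0 < k \<Longrightarrow> profile n (\<alpha> - 1 / real k) \<le> m" and m: "0 \<le> m"
  shows "profile n \<alpha> \<le> m"
proof (cases "\<alpha> \<le> 0")
  case True
  then show ?thesis using m by (simp add: profile_nonpos)
next
  case False
  then have "isCont (profile n) \<alpha>"
    using profile_continuous[of n] by (simp add: continuous_on_eq_continuous_at)
  moreover have "(\<lambda>k. \<alpha> - 1 / real (Suc k)) \<longlonglongrightarrow> \<alpha> - 0"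
    by (intro tendsto_diff tendsto_const LIMSEQ_Suc[OF lim_1_over_n])
  ultimately have "(\<lambda>k. profile n (\<alpha> - 1 / real (Suc k))) \<longlonglongrightarrow> profile n \<alpha>"
    using isCont_tendsto_compose by fastforce
  moreover have "profile n (\<alpha> - 1 / real (Suc k)) \<le> m" for k
    by (rule bound) simp
  ultimately show ?thesis
    by (intro LIMSEQ_le_const2) auto
qed

section \<open>Induction on the dimension\<close>

text \<open>
  Induction on the set of coordinates: a slice of \<open>B\<close> contains the neighbourhoods, in one dimension
  less, of all slices of \<open>A\<close> at heights within \<open>\<delta>\<close>. The set \<open>B\<close> takes the place of the neighbourhood
  of \<open>A\<close>, so that the measurability of neighbourhoods of slices need not be discussed.
\<close>

theorem cube_isoperimetry:
  fixes I :: "'i set"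
  assumes "finite I" "A \<in> sets (PiM I (\<lambda>_. lborel))" "B \<in> sets (PiM I (\<lambda>_. lborel))"
    "A \<subseteq> (\<Pi>\<^sub>E i\<in>I. {0..1})" "B \<subseteq> (\<Pi>\<^sub>E i\<in>I. {0..1})"
    "\<And>a x. \<lbrakk>a \<in> A; x \<in> (\<Pi>\<^sub>E i\<in>I. {0..1::real}); \<And>i. i \<in> I \<Longrightarrow> \<bar>x i - a i\<bar> < \<delta>\<rbrakk> \<Longrightarrow> x \<in> B"
  shows "profile (card I) (measure (PiM I (\<lambda>_. lborel)) A) \<le> measure (PiM I (\<lambda>_. lborel)) B"
  using assms
proof (induction I arbitrary: A B rule: finite_induct)
  case empty
  show ?case
  proof (cases "A = {}")
    case True
    then show ?thesis by (simp add: profile_nonpos)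
  next
    case False
    then have "A = {\<lambda>_. undefined}" using empty by auto
    moreover then have "B = {\<lambda>_. undefined}" using empty by auto
    ultimately show ?thesis by (simp add: measure_def profile_0)
  qed
next
  case (insert i I)
  let ?N = "PiM I (\<lambda>_. lborel :: real measure)"
  let ?sl = "\<lambda>X s. {x \<in> space ?N. x(i := s) \<in> X}"
  define f where "f s = measure ?N (?sl A s)" for s
  define b where "b s = measure ?N (?sl B s)" for s
  note fA = cube_slices[OF insert.hyps insert.prems(1,3), folded f_def]
  note bB = cube_slices[OF insert.hyps insert.prems(2,4), folded b_def]
  let ?M = "PiM (insert i I) (\<lambda>_. lborel :: real measure)"
  have fb: "profile (card I) (f e) \<le> b s" if s: "s \<in> {0..1}" "\<bar>s - e\<bar> < \<delta>" for s e
    unfolding f_def b_def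
  proof (rule insert.IH)
    show "?sl A e \<in> sets ?N" "?sl B s \<in> sets ?N" by (rule fA bB)+
    show "?sl A e \<subseteq> (\<Pi>\<^sub>E j\<in>I. {0..1})" "?sl B s \<subseteq> (\<Pi>\<^sub>E j\<in>I. {0..1})"
      using insert.prems insert.hyps by (auto intro!: slice_subset_cube del: subsetI)
    fix a x assume a: "a \<in> ?sl A e" and x: "x \<in> (\<Pi>\<^sub>E j\<in>I. {0..1::real})"
      and near: "\<And>j. j \<in> I \<Longrightarrow> \<bar>x j - a j\<bar> < \<delta>"
    have "x(i := s) \<in> B"
    proof (rule insert.prems(5))
      show "a(i := e) \<in> A" using a by simp
      show "x(i := s) \<in> (\<Pi>\<^sub>E j\<in>insert i I. {0..1})" using x s by (auto simp: PiE_iff extensional_def)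
      show "\<bar>(x(i := s)) j - (a(i := e)) j\<bar> < \<delta>" if "j \<in> insert i I" for j
        using that s near insert.hyps by auto
    qed
    then show "x \<in> ?sl B s" using x by (auto simp: space_PiM PiE_iff)
  qed
  have "profile (Suc (card I)) (measure ?M A) \<le> measure ?M B"
  proof (rule profile_limit)
    show "profile (Suc (card I)) (measure ?M A - 1 / real k) \<le> measure ?M B" if "0 < k" for k :: nat
      using layered_bound[OF fA(2,3,4,5,6,7) bB(6,3) fb that] bB(7) by simp
    have "integral\<^sup>L lborel f \<le> integral\<^sup>L lborel (indicator {0..1::real})"
      by (rule integral_mono) (use fA in \<open>auto simp: indicator_def\<close>)
    then show "measure ?M A \<le> 1" using fA(7) by simp
  qed simp
  then show ?case using insert.hyps by simp
qed

end

section \<open>Corner boxes in Euclidean space\<close>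

lemma mem_unit_cube: "x \<in> unit_cube \<longleftrightarrow> (\<forall>i. 0 \<le> x $ i \<and> x $ i \<le> 1)"
  by (simp add: unit_cube_def mem_box_cart)

lemma mem_unit_cube_Basis:
  fixes x :: "real ^ 'n"
  shows "x \<in> unit_cube \<longleftrightarrow> (\<forall>b\<in>Basis. x \<bullet> b \<in> {0..1})"
  by (auto simp: mem_unit_cube Basis_vec_def cart_eq_inner_axis)

lemma infnorm_less_iff:
  fixes x :: "'a::euclidean_space"
  shows "infnorm x < r \<longleftrightarrow> (\<forall>b\<in>Basis. \<bar>x \<bullet> b\<bar> < r)"
  by (simp add: infnorm_Max)

lemma infnorm_less_imp_component: "infnorm x < r \<Longrightarrow> \<bar>x $ i\<bar> < r" for x :: "real ^ 'n"
  using component_le_infnorm_cart[of x i] by simp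

lemma open_linf_nhd: "open (linf_nhd r A)"
proof -
  have "linf_nhd r A = (\<Union>a\<in>A. {x. infnorm (x - a) < r})"
    by (auto simp: linf_nhd_def)
  moreover have "open {x. infnorm (x - a) < r}" for a
    by (intro open_Collect_less continuous_intros)
  ultimately show ?thesis by auto
qed

lemma unit_cube_borel: "unit_cube \<in> sets borel"
  by (simp add: unit_cube_def)

lemma unit_cube_lmeasurable: "unit_cube \<in> lmeasurable"
  by (simp add: unit_cube_def)

definition corner :: "'n set \<Rightarrow> real \<Rightarrow> (real ^ 'n) set"
  where "corner S c = cbox 0 (\<chi> i. if i \<in> S then c else 1)"

lemma mem_corner: "x \<in> corner S c \<longleftrightarrow> (\<forall>i. 0 \<le> x $ i \<and> x $ i \<le> (if i \<in> S then c else 1))"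
  by (simp add: corner_def mem_box_cart)

lemma corner_subset: "c \<le> 1 \<Longrightarrow> corner S c \<subseteq> unit_cube"
  by (force simp: mem_corner mem_unit_cube split: if_splits)

lemma corner_lmeasurable: "corner S c \<in> lmeasurable"
  by (simp add: corner_def)

lemma measure_corner:
  fixes S :: "'n::finite set"
  assumes "0 \<le> c"
  shows "measure lebesgue (corner S c) = c ^ card S"
proof -
  have "0 \<in> corner S c" using assms by (simp add: mem_corner)
  then have "corner S c \<noteq> {}" by blast
  then have "measure lebesgue (corner S c) = (\<Prod>i\<in>UNIV. if i \<in> S then c else 1)"
    unfolding corner_def by (simp add: content_cbox_cart)
  then show ?thesis by (simp add: prod.If_cases)
qed

lemma measure_unit_cube: "measure lebesgue (unit_cube :: (real ^ 'n) set) = 1"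
proof -
  have "corner {} 1 = (unit_cube :: (real ^ 'n) set)" by (auto simp: mem_corner mem_unit_cube)
  then show ?thesis using measure_corner[of 1 "{} :: 'n set"] by simp
qed

lemma nhd_corner_subset:
  assumes "c + r \<le> d"
  shows "linf_nhd r (corner S c) \<inter> unit_cube \<subseteq> corner S d"
proof
  fix x assume x: "x \<in> linf_nhd r (corner S c) \<inter> unit_cube"
  then obtain a where a: "a \<in> corner S c" "infnorm (x - a) < r" by (auto simp: linf_nhd_def)
  have "x $ i \<le> d" if "i \<in> S" for i
  proof -
    have "a $ i \<le> c" using a(1) that by (auto simp: mem_corner dest: spec[of _ i])
    then show ?thesis using infnorm_less_imp_component[OF a(2), of i] assms by simp
  qed
  then show "x \<in> corner S d" using x by (auto simp: mem_corner mem_unit_cube)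
qed

lemma nhd_cocorner_subset:
  "linf_nhd r (unit_cube - corner S d) \<inter> unit_cube \<subseteq> unit_cube - corner S (d - r)"
proof
  fix x assume x: "x \<in> linf_nhd r (unit_cube - corner S d) \<inter> unit_cube"
  then obtain a where a: "a \<in> unit_cube" "a \<notin> corner S d" "infnorm (x - a) < r" by (auto simp: linf_nhd_def)
  have "\<exists>i\<in>S. d < a $ i"
  proof (rule ccontr)
    assume "\<not> (\<exists>i\<in>S. d < a $ i)"
    then have "a \<in> corner S d" using a(1) by (auto simp: mem_corner mem_unit_cube not_less)
    then show False using a(2) by simp
  qed
  then obtain i where i: "i \<in> S" "d < a $ i" by blast
  then have "\<not> x $ i \<le> d - r" using infnorm_less_imp_component[OF a(3), of i] by auto
  then have "x \<notin> corner S (d - r)" using i(1) by (auto simp: mem_corner dest!: spec[of _ i])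
  then show "x \<in> unit_cube - corner S (d - r)" using x by auto
qed

context enlargement
begin

text \<open>
  Lebesgue measure is the image of the product measure over the coordinates.
\<close>

lemma borel_cube_isoperimetry:
  fixes A B :: "(real ^ 'n) set"
  assumes A: "A \<in> sets borel" "A \<subseteq> unit_cube" and B: "B \<in> sets borel" "B \<subseteq> unit_cube"
    and AB: "linf_nhd \<delta> A \<inter> unit_cube \<subseteq> B"
  shows "profile CARD('n) (measure lborel A) \<le> measure lborel B"
proof -
  let ?I = "Basis :: (real ^ 'n) set"
  let ?P = "PiM ?I (\<lambda>_. lborel :: real measure)"
  define T where "T f = (\<Sum>b\<in>?I. f b *\<^sub>R b)" for f :: "real ^ 'n \<Rightarrow> real"
  have leb: "(lborel :: (real ^ 'n) measure) = distr ?P borel T"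
    unfolding T_def[abs_def] by (rule lborel_eq)
  have Tm: "T \<in> ?P \<rightarrow>\<^sub>M borel" unfolding T_def[abs_def] by measurable
  have Tb: "T f \<bullet> b = f b" if "b \<in> ?I" for f b
    using that by (simp add: T_def)
  have meas: "measure lborel X = measure ?P (T -` X \<inter> space ?P)" if "X \<in> sets borel" for X
    unfolding leb using Tm that by (rule measure_distr)
  have sets: "T -` X \<inter> space ?P \<in> sets ?P" if "X \<in> sets borel" for X
    using Tm that by (rule measurable_sets)
  have cube: "T -` X \<inter> space ?P \<subseteq> (\<Pi>\<^sub>E b\<in>?I. {0..1})" if "X \<subseteq> unit_cube" for X
  proof
    fix f assume f: "f \<in> T -` X \<inter> space ?P"
    then have "T f \<in> unit_cube" using that by auto
    then show "f \<in> (\<Pi>\<^sub>E b\<in>?I. {0..1})"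
      using f by (auto simp: mem_unit_cube_Basis Tb space_PiM PiE_iff)
  qed
  have "profile (card ?I) (measure ?P (T -` A \<inter> space ?P)) \<le> measure ?P (T -` B \<inter> space ?P)"
  proof (rule cube_isoperimetry[OF _ sets[OF A(1)] sets[OF B(1)] cube[OF A(2)] cube[OF B(2)]])
    fix a x
    assume a: "a \<in> T -` A \<inter> space ?P" and x: "x \<in> (\<Pi>\<^sub>E b\<in>?I. {0..1::real})"
      and near: "\<And>b. b \<in> ?I \<Longrightarrow> \<bar>x b - a b\<bar> < \<delta>"
    have "infnorm (T x - T a) < \<delta>"
      using near by (simp add: infnorm_less_iff inner_diff_left Tb)
    moreover have "T x \<in> unit_cube" using x by (auto simp: mem_unit_cube_Basis Tb PiE_iff)
    ultimately have "T x \<in> B" using a AB by (auto simp: linf_nhd_def)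
    then show "x \<in> T -` B \<inter> space ?P" using x by (auto simp: space_PiM PiE_iff)
  qed simp
  then show ?thesis using A B by (simp add: meas)
qed

text \<open>
  A Lebesgue set has a Borel subset of the same measure, and the neighbourhood of the subset is
  contained in the neighbourhood of the set.
\<close>

lemma nhd_measure_ge_profile:
  fixes A :: "(real ^ 'n) set"
  assumes A: "A \<in> sets lebesgue" "A \<subseteq> unit_cube"
  shows "profile CARD('n) (measure lebesgue A) \<le> measure lebesgue (linf_nhd \<delta> A \<inter> unit_cube)"
proof -
  let ?A = "main_part lborel A"
  have sub: "?A \<subseteq> A" using main_part_null_part_Un[OF A(1)] by blast
  have B: "linf_nhd \<delta> A \<inter> unit_cube \<in> sets borel"
    by (rule sets.Int[OF borel_open[OF open_linf_nhd] unit_cube_borel])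
  have "profile CARD('n) (measure lborel ?A) \<le> measure lborel (linf_nhd \<delta> A \<inter> unit_cube)"
  proof (rule borel_cube_isoperimetry)
    show "?A \<in> sets borel" using main_part_sets[OF A(1)] by simp
    show "linf_nhd \<delta> ?A \<inter> unit_cube \<subseteq> linf_nhd \<delta> A \<inter> unit_cube"
      using sub by (auto simp: linf_nhd_def)
  qed (use sub A B in auto)
  moreover have "measure lebesgue A = measure lborel ?A"
    using A(1) by (simp add: measure_def)
  ultimately show ?thesis using B by (simp add: measure_completion)
qed

lemma profile_cases:
  assumes "0 < p"
  obtains "profile n p = 1" | t where "t \<in> {1..n}" "profile n p = grow t p"
    | t where "t \<in> {1..n}" "profile n p = cogrow t p"
proof -
  let ?S = "{1} \<union> (\<Union>t\<in>{1..n}. {grow t p, cogrow t p})"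
  have "Min ?S \<in> ?S" by (rule Min_in) auto
  then show thesis using that assms by (auto simp: profile_def)
qed

text \<open>
  Each member of the minimum belongs to the whole cube, a corner box or the complement of one. The
  inequality for the neighbourhood suffices here; the lower bound turns it into an equality.
\<close>

lemma profile_attained:
  assumes \<alpha>: "0 < \<alpha>" "\<alpha> \<le> 1"
  obtains A :: "(real ^ 'n) set"
  where "A \<subseteq> unit_cube" "A \<in> sets lebesgue" "\<alpha> \<le> measure lebesgue A"
    "measure lebesgue (linf_nhd \<delta> A \<inter> unit_cube) \<le> profile CARD('n) \<alpha>"
proof -
  let ?nhd = "\<lambda>A :: (real ^ 'n) set. linf_nhd \<delta> A \<inter> unit_cube"
  have nhd: "?nhd A \<in> sets lebesgue" for A
    using sets.Int[OF borel_open[OF open_linf_nhd] unit_cube_borel] by (intro sets_completionI_sets) simp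
  have nhd_le: "measure lebesgue (?nhd A) \<le> measure lebesgue X" if "?nhd A \<subseteq> X" "X \<in> lmeasurable" for A X
    using that nhd by (intro measure_mono_fmeasurable)
  have nhd_le_1: "measure lebesgue (?nhd A) \<le> 1" for A
    using nhd_le[of A unit_cube] unit_cube_lmeasurable by (simp add: measure_unit_cube)
  have minus: "measure lebesgue (unit_cube - corner S c) = 1 - c ^ card S"
    if "0 \<le> c" "c \<le> 1" for S :: "'n set" and c
    using that by (subst measurable_measure_Diff)
      (auto simp: measure_corner measure_unit_cube corner_subset fmeasurableD corner_lmeasurable unit_cube_lmeasurable)
  consider "profile CARD('n) \<alpha> = 1"
    | t where "t \<in> {1..CARD('n)}" "profile CARD('n) \<alpha> = grow t \<alpha>"
    | t where "t \<in> {1..CARD('n)}" "profile CARD('n) \<alpha> = cogrow t \<alpha>"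
    using profile_cases[OF \<alpha>(1), of "CARD('n)"] by metis
  then show thesis
  proof cases
    case 1
    show thesis
      by (rule that[of unit_cube])
        (use 1 \<alpha> nhd_le_1 in \<open>auto simp: fmeasurableD measure_unit_cube unit_cube_lmeasurable\<close>)
  next
    case (2 t)
    obtain S :: "'n set" where S: "card S = t"
      using obtain_subset_with_card_n[of t UNIV] 2(1) by auto
    let ?c = "root t \<alpha>"
    have c: "0 \<le> ?c" "?c \<le> 1" "?c ^ t = \<alpha>" using \<alpha> 2(1) by auto
    show thesis
    proof (rule that[of "corner S ?c"])
      have "measure lebesgue (?nhd (corner S ?c)) \<le> measure lebesgue (corner S (?c + \<delta>))"
        by (intro nhd_le nhd_corner_subset corner_lmeasurable order_refl)
      then show "measure lebesgue (?nhd (corner S ?c)) \<le> profile CARD('n) \<alpha>"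
        using c \<delta>_pos S by (simp add: measure_corner 2(2) grow_def)
    qed (use c S corner_subset in \<open>auto simp: measure_corner fmeasurableD corner_lmeasurable\<close>)
  next
    case (3 t)
    obtain S :: "'n set" where S: "card S = t"
      using obtain_subset_with_card_n[of t UNIV] 3(1) by auto
    let ?d = "root t (1 - \<alpha>)"
    have d: "0 \<le> ?d" "?d \<le> 1" "?d ^ t = 1 - \<alpha>" using \<alpha> 3(1) by auto
    show thesis
    proof (rule that[of "unit_cube - corner S ?d"])
      show "measure lebesgue (?nhd (unit_cube - corner S ?d)) \<le> profile CARD('n) \<alpha>"
      proof (cases "\<delta> \<le> ?d")
        case True
        have "measure lebesgue (?nhd (unit_cube - corner S ?d)) \<le> measure lebesgue (unit_cube - corner S (?d - \<delta>))"
          by (intro nhd_le nhd_cocorner_subset fmeasurable.Diff corner_lmeasurable unit_cube_lmeasurable)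
        then show ?thesis
          using True d \<delta>_pos S by (simp add: minus 3(2) cogrow_def shrink_def)
      next
        case False
        then have "cogrow t \<alpha> = 1" using 3(1) by (simp add: cogrow_def shrink_def zero_power)
        then show ?thesis using nhd_le_1 3(2) by simp
      qed
    qed (use d S in \<open>auto simp: minus fmeasurableD corner_lmeasurable unit_cube_lmeasurable\<close>)
  qed
qed

lemma Min_powr_eq_profile:
  assumes "0 < \<alpha>" "\<alpha> \<le> 1"
  shows "Min ({1} \<union> (\<Union>t\<in>{1..n}.
       {(\<alpha> powr (1 / real t) + \<delta>) ^ t,
        1 - (max 0 ((1 - \<alpha>) powr (1 / real t) - \<delta>)) ^ t})) = profile n \<alpha>"
proof -
  have "{(\<alpha> powr (1 / real t) + \<delta>) ^ t, 1 - (max 0 ((1 - \<alpha>) powr (1 / real t) - \<delta>)) ^ t}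
      = {grow t \<alpha>, cogrow t \<alpha>}" if "t \<in> {1..n}" for t
    using that assms by (simp add: grow_def cogrow_def shrink_def root_powr_inverse)
  then have "(\<Union>t\<in>{1..n}. {(\<alpha> powr (1 / real t) + \<delta>) ^ t, 1 - (max 0 ((1 - \<alpha>) powr (1 / real t) - \<delta>)) ^ t})
      = (\<Union>t\<in>{1..n}. {grow t \<alpha>, cogrow t \<alpha>})"
    by (rule SUP_cong[OF refl])
  then show ?thesis using assms by (simp add: profile_def)
qed

end

theorem theorem1p1:
  fixes \<alpha> \<delta> :: real
  assumes "0 < \<alpha>" and "\<alpha> \<le> 1" and "0 < \<delta>" and "\<delta> \<le> 1"
  shows "is_minimum
    {measure lebesgue (linf_nhd \<delta> A \<inter> unit_cube) | A :: (real ^ 'n) set.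
       A \<subseteq> unit_cube \<and> A \<in> sets lebesgue \<and> measure lebesgue A \<ge> \<alpha>}
    (Min ({1} \<union> (\<Union>t\<in>{1..CARD('n)}.
       {(\<alpha> powr (1 / real t) + \<delta>) ^ t,
        1 - (max 0 ((1 - \<alpha>) powr (1 / real t) - \<delta>)) ^ t})))"
proof -
  interpret enlargement \<delta> using assms by unfold_locales
  have lower: "profile CARD('n) \<alpha> \<le> measure lebesgue (linf_nhd \<delta> A \<inter> unit_cube)"
    if "A \<subseteq> unit_cube" "A \<in> sets lebesgue" "\<alpha> \<le> measure lebesgue A" for A :: "(real ^ 'n) set"
  proof -
    have "measure lebesgue A \<le> 1"
      using measure_mono_fmeasurable[OF that(1,2) unit_cube_lmeasurable] by (simp add: measure_unit_cube)
    then have "profile CARD('n) \<alpha> \<le> profile CARD('n) (measure lebesgue A)"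
      using that by (intro profile_mono)
    also have "\<dots> \<le> measure lebesgue (linf_nhd \<delta> A \<inter> unit_cube)"
      using that by (intro nhd_measure_ge_profile)
    finally show ?thesis .
  qed
  obtain A :: "(real ^ 'n) set" where A: "A \<subseteq> unit_cube" "A \<in> sets lebesgue" "\<alpha> \<le> measure lebesgue A"
    "measure lebesgue (linf_nhd \<delta> A \<inter> unit_cube) \<le> profile CARD('n) \<alpha>"
    using profile_attained[OF assms(1,2)] by metis
  then have "profile CARD('n) \<alpha> = measure lebesgue (linf_nhd \<delta> A \<inter> unit_cube)"
    using lower by (intro antisym) auto
  then show ?thesis
    unfolding Min_powr_eq_profile[OF assms(1,2)] is_minimum_def using A lower by blast
qed

end
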